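(* If $\theta\in(\tfrac12,1)$, then for all $k\ge1$, $$\beta_{2k}^{(\theta)}\le\beta_{2k}^{(1)}=\beta_{2k}^{(Rev.\,Circ.)}=k!.$$
   Context: For $\theta\in(0,\infty)$ and $n$ large enough that $\lfloor n/\theta\rfloor\ge1$, let $L_\theta(i,j)=(i+j)\bmod\lfloor n/\theta\rfloor$ for $1\le i,j\le n$, and $A_n^\theta=n^{-1/2}((x_{L_\theta(i,j)}))_{1\le i,j\le n}$, where the real random variables $\{x_i\}_{i\ge0}$ satisfy one of: (1) independent, uniformly bounded, mean $0$, variance $1$; (2) i.i.d. with mean $0$ and variance $1$; (3) independent with mean $0$, variance $1$ and uniformly bounded moments of all orders. Let $F_\theta$ be the limiting spectral distribution (LSD) of $A_n^\theta$, i.e. the non-random distribution function to which, almost surely, the empirical spectral distribution of $A_n^\theta$ converges weakly; it exists and does not depend on the choice of such input sequence. Set $\beta_h^{(\theta)}=\int x^h\,dF_\theta(x)$. $\beta_{2k}^{(Rev.\,Circ.)}$ denotes the $2k$-th moment of the LSD of the Reverse Circulant matrices $RC_n=n^{-1/2}((x_{(i+j)\bmod n}))_{1\le i,j\le n}$. The moments satisfy $\beta_{2k}^{(\theta)}=\sum_w p_\theta(w)$, the sum being over pair-matched words $w$ of length $2k$ (sequences of $2k$ letters, first occurrences in alphabetical order, each letter appearing exactly twice), where $p_\theta(w)=\lim_n n^{-(k+1)}\#\Pi^*_\theta(w)$ exists and $\Pi^*_\theta(w)$ is the set of $\pi:\{0,\dots,2k\}\to\{1,\dots,n\}$ with $\pi(0)=\pi(2k)$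 such that $w[i]=w[j]$ implies $L_\theta(\pi(i-1),\pi(i))=L_\theta(\pi(j-1),\pi(j))$. *)

theory Defs
  imports "HOL-Probability.Probability" "Jordan_Normal_Form.Char_Poly"
begin

definition standardized :: "'a measure \<Rightarrow> (nat \<Rightarrow> 'a \<Rightarrow> real) \<Rightarrow> bool" where
  "standardized M x \<longleftrightarrow> (\<forall>i. x i \<in> borel_measurable M \<and>
     integrable M (x i) \<and> integrable M (\<lambda>\<omega>. (x i \<omega>)\<^sup>2) \<and>
     prob_space.expectation M (x i) = 0 \<and> prob_space.variance M (x i) = 1)"

definition uniformly_bounded :: "'a measure \<Rightarrow> (nat \<Rightarrow> 'a \<Rightarrow> real) \<Rightarrow> bool" where
  "uniformly_bounded M x \<longleftrightarrow> (\<exists>B. \<forall>i. AE \<omega> in M. \<bar>x i \<omega>\<bar> \<le> B)"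

definition identically_distributed :: "'a measure \<Rightarrow> (nat \<Rightarrow> 'a \<Rightarrow> real) \<Rightarrow> bool" where
  "identically_distributed M x \<longleftrightarrow> (\<forall>i j. distr M borel (x i) = distr M borel (x j))"

definition uniformly_bounded_moments :: "'a measure \<Rightarrow> (nat \<Rightarrow> 'a \<Rightarrow> real) \<Rightarrow> bool" where
  "uniformly_bounded_moments M x \<longleftrightarrow> (\<forall>p::nat. \<exists>C. \<forall>i.
     integrable M (\<lambda>\<omega>. \<bar>x i \<omega>\<bar> ^ p) \<and> prob_space.expectation M (\<lambda>\<omega>. \<bar>x i \<omega>\<bar> ^ p) \<le> C)"

definition input_sequence :: "'a measure \<Rightarrow> (nat \<Rightarrow> 'a \<Rightarrow> real) \<Rightarrow> bool" where
  "input_sequence M x \<longleftrightarrow> prob_space M \<and>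
     prob_space.indep_vars M (\<lambda>_. borel) x UNIV \<and> standardized M x \<and>
     (uniformly_bounded M x \<or> identically_distributed M x \<or> uniformly_bounded_moments M x)"

definition link :: "real \<Rightarrow> nat \<Rightarrow> nat \<Rightarrow> nat \<Rightarrow> nat" where
  "link \<theta> n i j = (i + j) mod nat \<lfloor>real n / \<theta>\<rfloor>"

text \<open>Matrix entries are addressed from 0 by \<^const>\<open>mat\<close>, whereas the row and column
  indices of the ensembles below run from 1 to \<open>n\<close>; hence the successors.\<close>

definition A_mat :: "real \<Rightarrow> (nat \<Rightarrow> real) \<Rightarrow> nat \<Rightarrow> real mat" where
  "A_mat \<theta> x n = mat n n (\<lambda>(i, j). x (link \<theta> n (Suc i) (Suc j)) / sqrt (real n))"

definition reverse_circulant :: "(nat \<Rightarrow> real) \<Rightarrow> nat \<Rightarrow> real mat" where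
  "reverse_circulant x n = mat n n (\<lambda>(i, j). x ((Suc i + Suc j) mod n) / sqrt (real n))"

text \<open>The empirical spectral distribution function counts eigenvalues with their algebraic
  multiplicity. It is only used for real symmetric matrices, whose characteristic polynomial
  has all its roots in the reals.\<close>

definition esd :: "real mat \<Rightarrow> real \<Rightarrow> real" where
  "esd A t = real (size {#l \<in># proots (char_poly A). l \<le> t#}) / real (dim_row A)"

text \<open>The limiting spectral distribution of a patterned ensemble \<open>E\<close> (a map taking a sequence of
  inputs and a size to a matrix) is the distribution to which the empirical spectral distribution
  converges weakly, almost surely, whatever the input sequence. Sample spaces are taken over the
  type \<^typ>\<open>nat \<Rightarrow> real\<close>, on which every sequence of real random variables has a copy with the
  same joint law.\<close>

definition is_LSD :: "((nat \<Rightarrow> real) \<Rightarrow> nat \<Rightarrow> real mat) \<Rightarrow> real measure \<Rightarrow> bool" where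
  "is_LSD E F \<longleftrightarrow> real_distribution F \<and>
     (\<forall>(M :: (nat \<Rightarrow> real) measure) x. input_sequence M x \<longrightarrow>
        (AE \<omega> in M. weak_conv (\<lambda>n. esd (E (\<lambda>i. x i \<omega>) n)) (cdf F)))"

definition moment :: "real measure \<Rightarrow> nat \<Rightarrow> real" where
  "moment F h = (\<integral>t. t ^ h \<partial>F)"

end

theory Submission
  imports Defs "Jordan_Normal_Form.Schur_Decomposition" "HOL-Number_Theory.Cong"
    "HOL-Combinatorics.Multiset_Permutations" "HOL-Real_Asymp.Real_Asymp"
begin

text \<open>Since the limit is the same for all inputs, take independent fair signs. The expected
  \<open>2 k\<close>-th moment of the empirical spectral distribution is then \<open>n\<^sup>-\<^sup>k\<^sup>-\<^sup>1\<close> times the number of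
  closed walks of length \<open>2 k\<close> on \<open>n\<close> vertices all of whose labels
  \<open>L (\<pi> (i - 1), \<pi> i)\<close> occur an even number of times. Along such a walk the labels have
  alternating sum \<open>0\<close> modulo \<open>m = \<lfloor>n / \<theta>\<rfloor>\<close>. If the odd and the even positions do not carry the same
  multiset of labels, this is a nontrivial linear condition, which leaves only \<open>O(n\<^sup>k)\<close> walks.
  Otherwise some bijection between odd and even positions matches the labels. Because
  \<open>n \<le> m\<close> for \<open>\<theta> \<le> 1\<close>, a vertex and a label determine the next vertex, so each of the \<open>k!\<close>
  bijections contributes at most \<open>n\<^sup>k\<^sup>+\<^sup>1\<close> walks, and asymptotically that many when \<open>m = n\<close>.
  Truncating \<open>t\<^sup>2\<^sup>k\<close> at a level \<open>K\<close> transfers the bound \<open>k!\<close> to the limit; the reverse bound for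
  \<open>\<theta> = 1\<close> follows from \<open>t\<^sup>2\<^sup>k \<le> min (t\<^sup>2\<^sup>k) K + t\<^sup>4\<^sup>k / K\<close>.\<close>

subsection \<open>Spectra of real symmetric matrices\<close>

text \<open>For an eigenvector \<open>v\<close>, the form \<open>S\<close> is \<open>e\<close> times
  the squared norm \<open>N\<close> of \<open>v\<close>. Symmetry of the real matrix makes
  \<open>S\<close> equal to its own conjugate, and \<open>N\<close> is nonzero, so \<open>e\<close>
  is fixed by conjugation.\<close>

lemma eigenvalue_symmetric_real:
  fixes A :: "real mat"
  assumes A: "A \<in> carrier_mat n n" and sym: "\<And>i j. i < n \<Longrightarrow> j < n \<Longrightarrow> A $$ (i, j) = A $$ (j, i)"
    and ev: "eigenvalue (map_mat complex_of_real A) e"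
  shows "of_real (Re e) = e"
proof -
  let ?C = "map_mat complex_of_real A"
  have C: "?C \<in> carrier_mat n n"
    using A by auto
  obtain v where v: "v \<in> carrier_vec n" "v \<noteq> 0\<^sub>v n" "?C *\<^sub>v v = e \<cdot>\<^sub>v v"
    using ev A unfolding eigenvalue_def eigenvector_def by auto
  define S where "S = (\<Sum>i<n. \<Sum>j<n. A $$ (i, j) * v $ j * cnj (v $ i))"
  define N where "N = (\<Sum>i<n. (cmod (v $ i))\<^sup>2)"
  have row: "(\<Sum>j<n. A $$ (i, j) * v $ j) = e * v $ i" if "i < n" for i
  proof -
    have "(?C *\<^sub>v v) $ i = (e \<cdot>\<^sub>v v) $ i"
      using v(3) by simp
    then show ?thesis
      using that A v(1) by (simp add: scalar_prod_def lessThan_atLeast0)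
  qed
  have "S = (\<Sum>i<n. e * (v $ i * cnj (v $ i)))"
    unfolding S_def
    by (rule sum.cong) (simp_all add: row mult.assoc[symmetric] flip: sum_distrib_right)
  also have "\<dots> = e * of_real N"
    unfolding N_def by (simp add: sum_distrib_left complex_norm_square del: of_real_power)
  finally have S: "S = e * of_real N" .
  have "cnj S = (\<Sum>i<n. \<Sum>j<n. A $$ (j, i) * v $ i * cnj (v $ j))"
    unfolding S_def by (simp add: sym mult.commute mult.left_commute)
  also have "\<dots> = S"
    unfolding S_def by (rule sum.swap)
  finally have "cnj e * of_real N = e * of_real N"
    using S by simp
  moreover have "N \<noteq> 0"
  proof
    assume "N = 0"
    then have "v $ i = 0" if "i < n" for i
      using that unfolding N_def by (subst (asm) sum_nonneg_eq_0_iff) auto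
    with v(1) have "v = 0\<^sub>v n"
      by (intro eq_vecI) auto
    with v(2) show False
      by contradiction
  qed
  ultimately have "cnj e = e"
    by simp
  then show ?thesis
    by (simp add: complex_eq_iff)
qed

text \<open>Over the complex numbers the polynomial factors completely, and every root is real. The
  factorization descends because the embedding of the reals is injective on coefficients.\<close>

lemma char_poly_symmetric_splits:
  fixes A :: "real mat"
  assumes A: "A \<in> carrier_mat n n" and sym: "\<And>i j. i < n \<Longrightarrow> j < n \<Longrightarrow> A $$ (i, j) = A $$ (j, i)"
  obtains es where "char_poly A = (\<Prod>e\<leftarrow>es. [:- e, 1:])" "length es = n"
proof -
  interpret mp: map_poly_comm_ring_hom complex_of_real ..
  let ?C = "map_mat complex_of_real A"
  have C: "?C \<in> carrier_mat n n"
    using A by auto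
  obtain as where as: "char_poly ?C = (\<Prod>a\<leftarrow>as. [:- a, 1:])" "length as = n"
    using char_poly_factorized[OF C] by blast
  have re: "complex_of_real (Re a) = a" if "a \<in> set as" for a
  proof -
    have "poly (char_poly ?C) a = 0"
      using that unfolding as(1) by (auto simp: poly_prod_list prod_list_zero_iff)
    then have "eigenvalue ?C a"
      using eigenvalue_root_char_poly[OF C] by simp
    then show ?thesis
      by (intro eigenvalue_symmetric_real[OF A sym]) simp_all
  qed
  have "map_poly complex_of_real (char_poly A) = char_poly ?C"
    by (simp add: of_real_hom.char_poly_hom[OF A])
  also have "\<dots> = (\<Prod>a\<leftarrow>as. map_poly complex_of_real [:- Re a, 1:])"
    unfolding as(1) by (intro arg_cong[of _ _ prod_list] map_cong) (auto simp: re)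
  also have "\<dots> = map_poly complex_of_real (\<Prod>a\<leftarrow>as. [:- Re a, 1:])"
    by (simp add: mp.hom_prod_list o_def)
  finally have "char_poly A = (\<Prod>e\<leftarrow>map Re as. [:- e, 1:])"
    by (simp add: poly_eq_iff coeff_map_poly o_def)
  then show ?thesis
    using that[of "map Re as"] as(2) by simp
qed

lemma upper_triangular_pow:
  fixes B :: "'a :: comm_ring_1 mat"
  assumes B: "B \<in> carrier_mat n n" and ut: "upper_triangular B"
  shows "upper_triangular (B ^\<^sub>m h) \<and> (\<forall>i<n. (B ^\<^sub>m h) $$ (i, i) = B $$ (i, i) ^ h)"
proof (induction h)
  case 0
  then show ?case
    using B by auto
next
  case (Suc h)
  let ?P = "B ^\<^sub>m h"
  have P: "?P \<in> carrier_mat n n"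
    using B by simp
  have ent: "(B ^\<^sub>m Suc h) $$ (i, j) = (\<Sum>l<n. ?P $$ (i, l) * B $$ (l, j))" if "i < n" "j < n" for i j
    using that B P by (simp add: scalar_prod_def lessThan_atLeast0)
  have zP: "?P $$ (i, j) = 0" if "j < i" "i < n" for i j
    using Suc P that by (auto simp: upper_triangular_def)
  have zB: "B $$ (i, j) = 0" if "j < i" "i < n" for i j
    using ut B that by (auto simp: upper_triangular_def)
  have "upper_triangular (B ^\<^sub>m Suc h)"
  proof (rule upper_triangularI)
    fix i j assume ij: "j < i" "i < dim_row (B ^\<^sub>m Suc h)"
    then have "i < n" "j < n"
      using P B by (auto simp: )
    then have "(\<Sum>l<n. ?P $$ (i, l) * B $$ (l, j)) = 0"
      by (intro sum.neutral ballI) (metis ij(1) lessThan_iff linorder_cases mult_eq_0_iff mult_zero_left mult_zero_right order.strict_trans zB zP)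
    then show "(B ^\<^sub>m Suc h) $$ (i, j) = 0"
      using ent \<open>i < n\<close> \<open>j < n\<close> by simp
  qed
  moreover have "(B ^\<^sub>m Suc h) $$ (i, i) = B $$ (i, i) ^ Suc h" if i: "i < n" for i
  proof -
    have "(\<Sum>l<n. ?P $$ (i, l) * B $$ (l, i)) = (\<Sum>l\<in>{i}. ?P $$ (i, l) * B $$ (l, i))"
      using i by (intro sum.mono_neutral_right) (auto, metis linorder_neqE_nat mult_zero_left mult_zero_right zB zP)
    then show ?thesis
      using ent[OF i i] Suc i by simp
  qed
  ultimately show ?case
    by blast
qed

lemma trace_mult_commute:
  fixes A B :: "'a :: comm_semiring_0 mat"
  assumes "A \<in> carrier_mat n m" "B \<in> carrier_mat m n"
  shows "(\<Sum>i<n. (A * B) $$ (i, i)) = (\<Sum>i<m. (B * A) $$ (i, i))"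
proof -
  have "(\<Sum>i<n. (A * B) $$ (i, i)) = (\<Sum>i<n. \<Sum>j<m. A $$ (i, j) * B $$ (j, i))"
    using assms by (simp add: scalar_prod_def lessThan_atLeast0)
  also have "\<dots> = (\<Sum>j<m. \<Sum>i<n. A $$ (i, j) * B $$ (j, i))"
    by (rule sum.swap)
  also have "\<dots> = (\<Sum>i<m. (B * A) $$ (i, i))"
    using assms by (simp add: scalar_prod_def lessThan_atLeast0 mult.commute)
  finally show ?thesis .
qed

text \<open>Schur decomposition reduces the claim to a triangular matrix, where powers act entrywise
  on the diagonal; cyclicity of the trace removes the conjugating factors.\<close>

lemma sum_eigenvalues_power:
  fixes A :: "'a :: conjugatable_ordered_field mat"
  assumes A: "A \<in> carrier_mat n n" and split: "char_poly A = (\<Prod>e\<leftarrow>es. [:- e, 1:])"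
  shows "(\<Sum>e\<leftarrow>es. e ^ h) = (\<Sum>i<n. (A ^\<^sub>m h) $$ (i, i))"
proof -
  obtain B P Q where BPQ: "schur_decomposition A es = (B, P, Q)"
    by (cases "schur_decomposition A es")
  from schur_decomposition[OF A split BPQ]
  have sim: "similar_mat_wit A B P Q" and ut: "upper_triangular B" and diag: "diag_mat B = es"
    by auto
  note simD = similar_mat_witD2[OF A sim]
  have B: "B \<in> carrier_mat n n" and P: "P \<in> carrier_mat n n" and Q: "Q \<in> carrier_mat n n"
    using simD by auto
  have Bh: "B ^\<^sub>m h \<in> carrier_mat n n"
    using B by simp
  have pow: "A ^\<^sub>m h = P * (B ^\<^sub>m h) * Q"
    by (rule similar_mat_wit_pow_id[OF sim])
  have "(\<Sum>i<n. (A ^\<^sub>m h) $$ (i, i)) = (\<Sum>i<n. (Q * (P * B ^\<^sub>m h)) $$ (i, i))"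
    unfolding pow using P Q Bh by (intro trace_mult_commute) auto
  also have "Q * (P * B ^\<^sub>m h) = B ^\<^sub>m h"
    using assoc_mult_mat[OF Q P Bh] simD(2) left_mult_one_mat[OF Bh] by simp
  also have "(\<Sum>i<n. (B ^\<^sub>m h) $$ (i, i)) = (\<Sum>i<n. B $$ (i, i) ^ h)"
    using upper_triangular_pow[OF B ut] by simp
  also have "\<dots> = (\<Sum>e\<leftarrow>es. e ^ h)"
    unfolding diag[symmetric] diag_mat_def using B by (simp add: sum_list_sum_nth lessThan_atLeast0)
  finally show ?thesis ..
qed

text \<open>Since the characteristic polynomial splits over the reals, \<open>proots\<close> sees
  the whole spectrum. This is what makes \<open>esd\<close> a genuine distribution function and its
  power sums traces.\<close>

lemma
  fixes A :: "real mat"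
  assumes A: "A \<in> carrier_mat n n" and sym: "\<And>i j. i < n \<Longrightarrow> j < n \<Longrightarrow> A $$ (i, j) = A $$ (j, i)"
  shows size_proots_symmetric: "size (proots (char_poly A)) = n"
    and sum_proots_symmetric: "(\<Sum>r\<in>#proots (char_poly A). r ^ h) = (\<Sum>i<n. (A ^\<^sub>m h) $$ (i, i))"
proof -
  obtain es where es: "char_poly A = (\<Prod>e\<leftarrow>es. [:- e, 1:])" "length es = n"
    by (rule char_poly_symmetric_splits[OF A sym])
  have "proots (char_poly A) = mset es"
    unfolding es(1) by (induction es)
      (simp_all add: proots_mult prod_list_zero_iff image_iff del: mult_pCons_left)
  then show "size (proots (char_poly A)) = n"
    and "(\<Sum>r\<in>#proots (char_poly A). r ^ h) = (\<Sum>i<n. (A ^\<^sub>m h) $$ (i, i))"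
    using sum_eigenvalues_power[OF A es(1)] es(2) by (simp_all flip: sum_mset_sum_list)
qed

subsection \<open>Closed walks\<close>

text \<open>A closed walk is its base point together with the list of the later vertices, the last of
  which is the base point again.\<close>

definition circuits :: "nat \<Rightarrow> nat \<Rightarrow> (nat \<times> nat list) set" where
  "circuits n h = {(a, p). a < n \<and> length p = h \<and> set p \<subseteq> {..<n} \<and> last (a # p) = a}"

definition labels :: "(nat \<Rightarrow> nat \<Rightarrow> 'a) \<Rightarrow> nat \<Rightarrow> nat list \<Rightarrow> 'a list" where
  "labels f a p = map2 f (a # p) p"

lemma labels_Nil [simp]: "labels f a [] = []"
  and labels_Cons [simp]: "labels f a (b # p) = f a b # labels f b p"
  and length_labels [simp]: "length (labels f a p) = length p"
  by (simp_all add: labels_def)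

lemma nth_labels: "q < length p \<Longrightarrow> labels f a p ! q = f ((a # p) ! q) (p ! q)"
  by (simp add: labels_def)

lemma labels_snoc: "labels f a (p @ [b]) = labels f a p @ [f (last (a # p)) b]"
  by (induction p arbitrary: a) auto

lemma lists_length_Suc_snoc:
  "{p. length p = Suc h \<and> set p \<subseteq> S} = (\<lambda>(p, b). p @ [b]) ` ({p. length p = h \<and> set p \<subseteq> S} \<times> S)"
  (is "?L = ?R")
proof (intro equalityI subsetI)
  fix p assume "p \<in> ?L"
  then show "p \<in> ?R"
    by (cases p rule: rev_cases) auto
qed auto

text \<open>The weight \<open>g\<close> is kept arbitrary so that the induction can absorb the
  factor of the newly added last step into it. Taking for \<open>g\<close> the indicator of the
  starting vertex then selects the closed walks.\<close>

lemma mat_pow_row_sum: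
  fixes A :: "'a :: comm_semiring_1 mat"
  assumes A: "A \<in> carrier_mat n n" and a: "a < n"
  shows "(\<Sum>b<n. (A ^\<^sub>m h) $$ (a, b) * g b) =
    (\<Sum>p | length p = h \<and> set p \<subseteq> {..<n}. prod_list (labels (\<lambda>i j. A $$ (i, j)) a p) * g (last (a # p)))"
proof (induction h arbitrary: g)
  case 0
  have "(\<Sum>b<n. (1\<^sub>m n) $$ (a, b) * g b) = (\<Sum>b<n. if b = a then g b else 0)"
    using a by (intro sum.cong) auto
  then have "(\<Sum>b<n. (A ^\<^sub>m 0) $$ (a, b) * g b) = g a"
    using A a by simp
  moreover have "{p :: nat list. length p = 0 \<and> set p \<subseteq> {..<n}} = {[]}"
    by auto
  ultimately show ?case
    by simp
next
  case (Suc h)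
  let ?w = "\<lambda>p. prod_list (labels (\<lambda>i j. A $$ (i, j)) a p)"
  let ?L = "\<lambda>h. {p. length p = h \<and> set p \<subseteq> {..<n}}"
  have "(A ^\<^sub>m Suc h) $$ (a, b) = (\<Sum>c<n. (A ^\<^sub>m h) $$ (a, c) * A $$ (c, b))" if "b < n" for b
    using that A a by (simp add: scalar_prod_def lessThan_atLeast0)
  then have "(\<Sum>b<n. (A ^\<^sub>m Suc h) $$ (a, b) * g b) =
      (\<Sum>b<n. \<Sum>c<n. (A ^\<^sub>m h) $$ (a, c) * (A $$ (c, b) * g b))"
    by (simp add: sum_distrib_right mult.assoc)
  also have "\<dots> = (\<Sum>c<n. (A ^\<^sub>m h) $$ (a, c) * (\<Sum>b<n. A $$ (c, b) * g b))"
    by (subst sum.swap) (simp add: sum_distrib_left)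
  also have "\<dots> = (\<Sum>p\<in>?L h. ?w p * (\<Sum>b<n. A $$ (last (a # p), b) * g b))"
    by (rule Suc.IH)
  also have "\<dots> = (\<Sum>(p, b)\<in>?L h \<times> {..<n}. ?w (p @ [b]) * g (last (a # p @ [b])))"
    by (simp add: sum_distrib_left labels_snoc mult.assoc sum.cartesian_product del: last.simps)
      (simp add: case_prod_unfold)
  also have "\<dots> = (\<Sum>p\<in>?L (Suc h). ?w p * g (last (a # p)))"
    unfolding lists_length_Suc_snoc by (subst sum.reindex) (auto simp: inj_on_def case_prod_unfold)
  finally show ?case .
qed

lemma finite_circuits: "finite (circuits n h)"
proof (rule finite_subset)
  show "circuits n h \<subseteq> {..<n} \<times> {p. set p \<subseteq> {..<n} \<and> length p = h}"
    by (auto simp: circuits_def)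
qed (auto intro: finite_lists_length_eq)

lemma trace_pow_circuits:
  fixes A :: "'a :: comm_semiring_1 mat"
  assumes A: "A \<in> carrier_mat n n"
  shows "(\<Sum>a<n. (A ^\<^sub>m h) $$ (a, a)) =
    (\<Sum>(a, p)\<in>circuits n h. prod_list (labels (\<lambda>i j. A $$ (i, j)) a p))"
proof -
  let ?w = "\<lambda>a p. prod_list (labels (\<lambda>i j. A $$ (i, j)) a p)"
  let ?L = "{p. length p = h \<and> set p \<subseteq> {..<n}}"
  have fin: "finite ?L"
    using finite_lists_length_eq[of "{..<n}" h] by (simp add: conj_commute)
  have "(A ^\<^sub>m h) $$ (a, a) = (\<Sum>p\<in>{p \<in> ?L. last (a # p) = a}. ?w a p)" if a: "a < n" for a
  proof -
    have "(A ^\<^sub>m h) $$ (a, a) = (\<Sum>b<n. (A ^\<^sub>m h) $$ (a, b) * (if b = a then 1 else 0))"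
      using a by (simp add: if_distrib cong: if_cong)
    also have "\<dots> = (\<Sum>p\<in>?L. ?w a p * (if last (a # p) = a then 1 else 0))"
      by (rule mat_pow_row_sum[OF A a])
    also have "\<dots> = (\<Sum>p\<in>?L. if last (a # p) = a then ?w a p else 0)"
      by (intro sum.cong) auto
    also have "\<dots> = (\<Sum>p\<in>{p \<in> ?L. last (a # p) = a}. ?w a p)"
      using fin by (rule sum.inter_filter[symmetric])
    finally show ?thesis .
  qed
  then have "(\<Sum>a<n. (A ^\<^sub>m h) $$ (a, a)) =
      (\<Sum>a<n. \<Sum>p\<in>{p \<in> ?L. last (a # p) = a}. ?w a p)"
    by simp
  also have "\<dots> = (\<Sum>(a, p)\<in>(SIGMA a:{..<n}. {p \<in> ?L. last (a # p) = a}). ?w a p)"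
    using fin by (subst sum.Sigma) (auto simp del: last.simps intro: rev_finite_subset)
  also have "(SIGMA a:{..<n}. {p \<in> ?L. last (a # p) = a}) = circuits n h"
    by (auto simp: circuits_def)
  finally show ?thesis .
qed

subsection \<open>Counting circuits with even label multiplicities\<close>

text \<open>The link function with vertices numbered from 0, hence the successors, and with its
  modulus as a free parameter.\<close>

definition hankel_label :: "nat \<Rightarrow> nat \<Rightarrow> nat \<Rightarrow> nat" where
  "hankel_label m i j = (Suc i + Suc j) mod m"

text \<open>Translation by \<open>i + 2\<close> is injective on residues, and numbers below
  \<open>m\<close> are told apart by their residues. This is where the condition that the modulus be
  at least the number of vertices enters the counting.\<close>

lemma hankel_label_inject:
  assumes "hankel_label m i j = hankel_label m i j'" "j < m" "j' < m"
  shows "j = j'"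
proof -
  have "[(i + 2) + j = (i + 2) + j'] (mod m)"
    using assms(1) by (simp add: hankel_label_def cong_def)
  then have "[j = j'] (mod m)"
    by (simp only: cong_add_lcancel_nat)
  then show ?thesis
    using assms(2,3) by (simp add: cong_def)
qed

lemma hankel_label_surj:
  assumes "v < m"
  obtains j where "j < m" "hankel_label m i j = v"
proof -
  have m: "0 < m"
    using assms by simp
  \<comment> \<open>This is \<open>v - (i + 2)\<close> modulo \<open>m\<close>, with
    \<open>m\<close> added so that the subtraction on naturals does not truncate.\<close>
  let ?j = "(v + (m - (i + 2) mod m)) mod m"
  have "(Suc i + Suc ?j) mod m = ((i + 2) + ?j) mod m"
    by simp
  also have "\<dots> = ((i + 2) mod m + (v + (m - (i + 2) mod m))) mod m"
    by (rule mod_add_eq[symmetric, THEN trans]) (simp only: mod_mod_trivial mod_add_right_eq)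
  also have "(i + 2) mod m + (v + (m - (i + 2) mod m)) = v + m"
    using mod_less_divisor[OF m, of "i + 2"] by linarith
  finally have "hankel_label m i ?j = v"
    using assms by (simp add: hankel_label_def)
  then show ?thesis
    using that[of ?j] m by simp
qed

text \<open>Step \<open>q\<close> of a walk starts where step \<open>q - 1\<close> ended, or at the
  base point if \<open>q = 0\<close>; so walks that agree before \<open>q\<close> start step
  \<open>q\<close> at the same vertex.\<close>

lemma nth_Cons_eq_of_less:
  assumes "\<And>s. s < q \<Longrightarrow> p ! s = p' ! s"
  shows "(a # p) ! q = (a # p') ! q"
  using assms by (cases q) auto

lemma walk_determined_by_labels:
  assumes "length p = length p'" "set p \<subseteq> {..<m}" "set p' \<subseteq> {..<m}"
    and "labels (hankel_label m) a p = labels (hankel_label m) a p'"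
  shows "p = p'"
  using assms
proof (induction p p' arbitrary: a rule: list_induct2)
  case (Cons x xs y ys)
  then show ?case
    using hankel_label_inject[of m a x y] by auto
qed simp

text \<open>\<open>F\<close> holds the positions of the first occurrences: only there is the next vertex free.\<close>

lemma card_circuits_matched_le:
  assumes nm: "n \<le> m" and F: "F \<subseteq> {..<h}"
    and r: "\<And>q. q < h \<Longrightarrow> q \<notin> F \<Longrightarrow> r q < q"
  shows "card {(a, p) \<in> circuits n h. \<forall>q<h. q \<notin> F \<longrightarrow>
      labels (hankel_label m) a p ! q = labels (hankel_label m) a p ! r q} \<le> n * n ^ card F"
    (is "card ?S \<le> _")
proof -
  have finF: "finite F"
    using F finite_subset by blast
  let ?g = "\<lambda>(a, p). (a, restrict ((!) p) F)"
  have "inj_on ?g ?S"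
  proof (rule inj_onI, clarsimp)
    fix a p p'
    let ?l = "labels (hankel_label m) a"
    assume c: "(a, p) \<in> circuits n h" "(a, p') \<in> circuits n h"
      and m: "\<forall>q<h. q \<notin> F \<longrightarrow> ?l p ! q = ?l p ! r q" "\<forall>q<h. q \<notin> F \<longrightarrow> ?l p' ! q = ?l p' ! r q"
      and eq: "restrict ((!) p) F = restrict ((!) p') F"
    have len: "length p = h" "length p' = h" and sub: "set p \<subseteq> {..<m}" "set p' \<subseteq> {..<m}"
      using c nm by (auto simp: circuits_def)
    \<comment> \<open>The walk is rebuilt from left to right: outside \<open>F\<close> the label is
      copied from the earlier step \<open>r q\<close>, and together with the vertex already reached
      it fixes the next one.\<close>
    have "p ! q = p' ! q" if "q < h" for q
      using that
    proof (induction q rule: less_induct)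
      case (less q)
      show ?case
      proof (cases "q \<in> F")
        case True
        then show ?thesis
          using fun_cong[OF eq, of q] by simp
      next
        case False
        have rq: "r q < q"
          using r less.prems False by blast
        have vq: "(a # p) ! q = (a # p') ! q"
          using less by (intro nth_Cons_eq_of_less) auto
        have "?l p ! r q = ?l p' ! r q"
          using less rq len nth_Cons_eq_of_less[of "r q" p p' a] by (simp add: nth_labels)
        then have "?l p ! q = ?l p' ! q"
          using m less.prems False by simp
        then have "hankel_label m ((a # p) ! q) (p ! q) = hankel_label m ((a # p) ! q) (p' ! q)"
          using less.prems len vq by (simp add: nth_labels)
        moreover have "p ! q \<in> set p" "p' ! q \<in> set p'"
          using less.prems len by simp_all
        then have "p ! q < m" "p' ! q < m"
          using sub by blast+
        ultimately show ?thesis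
          by (rule hankel_label_inject)
      qed
    qed
    then show "p = p'"
      using len by (intro nth_equalityI) auto
  qed
  moreover have "?g ` ?S \<subseteq> {..<n} \<times> (F \<rightarrow>\<^sub>E {..<n})"
  proof (rule image_subsetI)
    fix x assume "x \<in> ?S"
    then obtain a p where x: "x = (a, p)" and c: "(a, p) \<in> circuits n h"
      by auto
    then have "p ! q \<in> {..<n}" if "q \<in> F" for q
      using that F nth_mem[of q p] unfolding circuits_def by blast
    then show "?g x \<in> {..<n} \<times> (F \<rightarrow>\<^sub>E {..<n})"
      using c x by (auto simp: circuits_def)
  qed
  moreover have "finite ({..<n} \<times> (F \<rightarrow>\<^sub>E {..<n}))"
    using finF by (intro finite_cartesian_product finite_PiE) auto
  ultimately have "card ?S \<le> card ({..<n} \<times> (F \<rightarrow>\<^sub>E {..<n}))"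
    by (rule card_inj_on_le)
  then show ?thesis
    using finF by (simp add: card_cartesian_product card_PiE)
qed

text \<open>Positions in a list count from \<open>0\<close>, so \<open>evens\<close> collects the labels of the first, third, \<open>\<dots>\<close>
  step of a walk.\<close>

definition evens :: "nat \<Rightarrow> 'a list \<Rightarrow> 'a list" where
  "evens k l = map (\<lambda>i. l ! (2 * i)) [0..<k]"

definition odds :: "nat \<Rightarrow> 'a list \<Rightarrow> 'a list" where
  "odds k l = map (\<lambda>i. l ! (2 * i + 1)) [0..<k]"

lemma length_evens [simp]: "length (evens k l) = k"
  and length_odds [simp]: "length (odds k l) = k"
  by (simp_all add: evens_def odds_def)

lemma mset_evens_odds:
  assumes "length l = 2 * k"
  shows "mset l = mset (evens k l) + mset (odds k l)"
proof -
  have "mset (map ((!) l) [0..<2 * j]) = mset (evens j l) + mset (odds j l)" for j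
    by (induction j) (auto simp: evens_def odds_def)
  from this[of k] show ?thesis
    using map_nth[of l] assms by metis
qed

text \<open>Equal multisets yield a permutation \<sigma> that pairs step \<open>2 * i\<close> with
  the equally labelled step \<open>2 * \<sigma> i + 1\<close>. For a fixed \<sigma>, only the base
  point and the end vertices of the earlier step in each of the \<open>k\<close> pairs are free, and
  there are \<open>fact k\<close> permutations.\<close>

lemma card_circuits_balanced_le:
  assumes nm: "n \<le> m"
  shows "card {(a, p) \<in> circuits n (2 * k). mset (evens k (labels (hankel_label m) a p)) =
      mset (odds k (labels (hankel_label m) a p))} \<le> fact k * n ^ (k + 1)"
    (is "card ?B \<le> _")
proof -
  let ?l = "labels (hankel_label m)"
  define C where "C \<sigma> = {(a, p) \<in> circuits n (2 * k). \<forall>i<k. ?l a p ! (2 * i) = ?l a p ! (2 * \<sigma> i + 1)}"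
    for \<sigma> :: "nat \<Rightarrow> nat"
  have "?B \<subseteq> (\<Union>\<sigma>\<in>{\<sigma>. \<sigma> permutes {..<k}}. C \<sigma>)"
  proof clarify
    fix a p assume c: "(a, p) \<in> circuits n (2 * k)"
      and "mset (evens k (?l a p)) = mset (odds k (?l a p))"
    then obtain \<sigma> where \<sigma>: "\<sigma> permutes {..<k}" "permute_list \<sigma> (odds k (?l a p)) = evens k (?l a p)"
      using mset_eq_permutation by (metis length_odds)
    have "?l a p ! (2 * i) = ?l a p ! (2 * \<sigma> i + 1)" if "i < k" for i
      using that \<sigma>(1) arg_cong[OF \<sigma>(2), of "\<lambda>l. l ! i"] permutes_in_image[OF \<sigma>(1), of i]
      by (simp add: permute_list_nth) (simp add: evens_def odds_def)
    then show "(a, p) \<in> (\<Union>\<sigma>\<in>{\<sigma>. \<sigma> permutes {..<k}}. C \<sigma>)"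
      using \<sigma>(1) c by (auto simp: C_def)
  qed
  moreover have finP: "finite {\<sigma>. \<sigma> permutes {..<k}}"
    by (simp add: finite_permutations)
  moreover have "finite (C \<sigma>)" for \<sigma>
    by (rule finite_subset[OF _ finite_circuits]) (auto simp: C_def)
  ultimately have "card ?B \<le> card (\<Union>\<sigma>\<in>{\<sigma>. \<sigma> permutes {..<k}}. C \<sigma>)"
    by (intro card_mono) auto
  also have "\<dots> \<le> (\<Sum>\<sigma>\<in>{\<sigma>. \<sigma> permutes {..<k}}. card (C \<sigma>))"
    by (rule card_UN_le[OF finP])
  also have "\<dots> \<le> (\<Sum>\<sigma>\<in>{\<sigma>. \<sigma> permutes {..<k}}. n * n ^ k)"
  proof (rule sum_mono, clarify)
    fix \<sigma> assume \<sigma>: "\<sigma> permutes {..<k}"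
    \<comment> \<open>\<open>F\<close> contains the earlier position of each pair, while
      \<open>r\<close> sends a position to its partner.\<close>
    define F where "F = (\<lambda>i. min (2 * i) (2 * \<sigma> i + 1)) ` {..<k}"
    define r where "r q = (if even q then 2 * \<sigma> (q div 2) + 1 else 2 * inv_into UNIV \<sigma> (q div 2))" for q
    have inv: "inv_into UNIV \<sigma> permutes {..<k}"
      by (rule permutes_inv[OF \<sigma>])
    have C: "C \<sigma> \<subseteq> {(a, p) \<in> circuits n (2 * k). \<forall>q<2 * k. q \<notin> F \<longrightarrow> ?l a p ! q = ?l a p ! r q}"
    proof (clarsimp simp: C_def)
      fix a p q assume "(a, p) \<in> circuits n (2 * k)" "q < 2 * k"
        and eq: "\<forall>i<k. ?l a p ! (2 * i) = ?l a p ! Suc (2 * \<sigma> i)"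
      then have q: "q div 2 < k"
        by auto
      show "?l a p ! q = ?l a p ! r q"
      proof (cases "even q")
        case True
        then have "q = 2 * (q div 2)"
          by simp
        with spec[OF eq, of "q div 2"] True q show ?thesis
          by (simp add: r_def)
      next
        case False
        then have q': "q = 2 * (q div 2) + 1"
          by (simp add: odd_two_times_div_two_succ)
        have "inv_into UNIV \<sigma> (q div 2) < k"
          using q permutes_in_image[OF inv, of "q div 2"] by simp
        moreover have "\<sigma> (inv_into UNIV \<sigma> (q div 2)) = q div 2"
          by (rule permutes_inverses(1)[OF \<sigma>])
        ultimately show ?thesis
          using spec[OF eq, of "inv_into UNIV \<sigma> (q div 2)"] q' False by (simp add: r_def)
      qed
    qed
    have less: "r q < q" if q: "q < 2 * k" "q \<notin> F" for q
    proof (cases "even q")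
      case True
      then obtain i where i: "q = 2 * i"
        by blast
      then have "min (2 * i) (2 * \<sigma> i + 1) \<in> F"
        using q by (auto simp: F_def)
      with q(2) i show ?thesis
        by (auto simp: r_def min_def split: if_splits)
    next
      case False
      then obtain j where j: "q = 2 * j + 1"
        by (blast elim: oddE)
      let ?i = "inv_into UNIV \<sigma> j"
      have "?i < k"
        using q j permutes_in_image[OF inv, of j] by simp
      then have "min (2 * ?i) (2 * \<sigma> ?i + 1) \<in> F"
        by (auto simp: F_def)
      with q(2) j show ?thesis
        by (auto simp: r_def min_def permutes_inverses(1)[OF \<sigma>] le_less split: if_splits)
    qed
    have F: "F \<subseteq> {..<2 * k}"
      by (auto simp: F_def min_less_iff_disj)
    have "card (C \<sigma>) \<le> card {(a, p) \<in> circuits n (2 * k). \<forall>q<2 * k. q \<notin> F \<longrightarrow> ?l a p ! q = ?l a p ! r q}"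
      by (rule card_mono[OF finite_subset[OF _ finite_circuits] C]) auto
    also have "\<dots> \<le> n * n ^ card F"
      by (rule card_circuits_matched_le[OF nm F less])
    also have "\<dots> \<le> n * n ^ k"
    proof (cases "n = 0")
      case False
      have "card F \<le> k"
        unfolding F_def using card_image_le[of "{..<k}"] by simp
      then show ?thesis
        using False by (simp add: power_increasing)
    qed simp
    finally show "card (C \<sigma>) \<le> n * n ^ k" .
  qed
  also have "\<dots> = fact k * n ^ (k + 1)"
    by (simp add: card_permutations[OF refl])
  finally show ?thesis .
qed

section \<open>Alternating label sums and unbalanced label words\<close>

lemma sum_alternating_telescope:
  fixes u :: "nat \<Rightarrow> 'a :: comm_ring_1"
  shows "(\<Sum>q<h. (- 1) ^ q * (u q + u (Suc q))) = u 0 - (- 1) ^ h * u h"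
  by (induction h) (auto simp: algebra_simps)

text \<open>Modulo \<open>m\<close> each label is the sum of two consecutive vertex numbers, so the
  alternating sum telescopes to its boundary terms. For even length these give base point minus end
  point, which is \<open>0\<close> on a closed walk.\<close>

lemma alternating_sum_labels_cong:
  "[(\<Sum>q<length p. (- 1) ^ q * int (labels (hankel_label m) a p ! q)) =
    int a + 1 - (- 1) ^ length p * (int (last (a # p)) + 1)] (mod int m)"
proof -
  define u where "u q = int ((a # p) ! q) + 1" for q
  have "[(- 1) ^ q * int (labels (hankel_label m) a p ! q) = (- 1) ^ q * (u q + u (Suc q))] (mod int m)"
    if "q < length p" for q
    using that by (intro cong_mult cong_refl)
      (simp add: nth_labels hankel_label_def u_def cong_def zmod_int mod_simps algebra_simps)
  then have "[(\<Sum>q<length p. (- 1) ^ q * int (labels (hankel_label m) a p ! q)) =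
      (\<Sum>q<length p. (- 1) ^ q * (u q + u (Suc q)))] (mod int m)"
    by (intro cong_sum) simp
  also have "(\<Sum>q<length p. (- 1) ^ q * (u q + u (Suc q))) = u 0 - (- 1) ^ length p * u (length p)"
    by (rule sum_alternating_telescope)
  also have "u (length p) = int (last (a # p)) + 1"
    by (simp add: u_def last_conv_nth del: last.simps)
  finally show ?thesis
    by (simp add: u_def)
qed

text \<open>Used twice: with \<open>f = int\<close> it shows that balanced label words satisfy the
  closing relation, and with \<open>f\<close> an indicator it expresses the coefficient of a letter
  as a difference of multiplicities.\<close>

lemma alternating_sum_evens_odds:
  fixes f :: "'a \<Rightarrow> 'b :: comm_ring_1"
  shows "(\<Sum>q<2 * k. (- 1) ^ q * f (l ! q)) = (\<Sum>x\<in>#mset (evens k l). f x) - (\<Sum>x\<in>#mset (odds k l). f x)"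
  by (induction k) (auto simp: evens_def odds_def algebra_simps)

text \<open>For positive \<open>c\<close> a solution is determined by the quotient of
  \<open>c * x + d\<close> by \<open>m\<close>. As \<open>x\<close> runs below \<open>m\<close>, the
  numerator stays in a half-open interval of length \<open>c * m\<close>, which leaves at most
  \<open>c\<close> integer quotients. Negative \<open>c\<close> is handled by changing all
  signs.\<close>

lemma card_linear_cong_le:
  fixes c d :: int
  assumes c: "c \<noteq> 0" and m: "0 < m"
  shows "card {x. x < m \<and> [c * int x + d = 0] (mod int m)} \<le> nat \<bar>c\<bar>"
proof -
  have pos: "card {x. x < m \<and> [c * int x + d = 0] (mod int m)} \<le> nat c" if c: "0 < c" for c d :: int
  proof -
    let ?S = "{x. x < m \<and> [c * int x + d = 0] (mod int m)}"
    \<comment> \<open>\<open>T\<close> is \<open>d / m\<close> rounded up, the least quotient that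
      can occur.\<close>
    define T where "T = - ((- d) div int m)"
    let ?g = "\<lambda>x. (c * int x + d) div int m"
    have g: "?g x * int m = c * int x + d" if "x \<in> ?S" for x
      using that by (simp add: cong_0_iff)
    have T: "d \<le> T * int m" "T * int m < d + int m"
    proof -
      have "- d = - T * int m + (- d) mod int m"
        unfolding T_def by simp
      moreover have "0 \<le> (- d) mod int m" "(- d) mod int m < int m"
        using m by simp_all
      ultimately show "d \<le> T * int m" "T * int m < d + int m"
        by simp_all
    qed
    have "inj_on ?g ?S"
    proof (rule inj_onI)
      fix x y assume xy: "x \<in> ?S" "y \<in> ?S" "?g x = ?g y"
      have "c * int x + d = c * int y + d"
        using g[OF xy(1)] g[OF xy(2)] xy(3) by metis
      then have "int x = int y"
        using c by simp
      then show "x = y"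
        using c by simp
    qed
    moreover have "?g ` ?S \<subseteq> {T..<T + c}"
    proof clarify
      fix x assume x: "x < m" "[c * int x + d = 0] (mod int m)"
      then have gx: "?g x * int m = c * int x + d"
        using g by blast
      have "(T - 1) * int m < ?g x * int m"
      proof -
        have "0 \<le> c * int x"
          using c by simp
        then show ?thesis
          unfolding gx using T by (simp add: left_diff_distrib)
      qed
      then have "T - 1 < ?g x"
        using m by (simp add: mult_less_cancel_right)
      moreover have "?g x * int m < (T + c) * int m"
      proof -
        have "c * int x < c * int m"
          using x c by simp
        then show ?thesis
          unfolding gx using T by (simp add: distrib_right)
      qed
      then have "?g x < T + c"
        using m by (simp add: mult_less_cancel_right)
      ultimately show "?g x \<in> {T..<T + c}"
        by simp
    qed
    ultimately have "card ?S \<le> card {T..<T + c}"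
      by (rule card_inj_on_le) simp
    then show ?thesis
      by simp
  qed
  show ?thesis
  proof (cases "0 < c")
    case True
    then show ?thesis
      using pos[of c d] by simp
  next
    case False
    have "[c * int x + d = 0] (mod int m) \<longleftrightarrow> [- c * int x + - d = 0] (mod int m)" for x
      using cong_minus_minus_iff[of "c * int x + d" 0 "int m"] by simp
    then show ?thesis
      using pos[of "- c" "- d"] False c by simp
  qed
qed

lemma card_le_mult_card_fibre:
  assumes "finite B" "f ` A \<subseteq> B" "\<And>y. y \<in> B \<Longrightarrow> finite {x \<in> A. f x = y}"
    and "\<And>y. y \<in> B \<Longrightarrow> card {x \<in> A. f x = y} \<le> c"
  shows "card A \<le> card B * c"
proof -
  have "A = (\<Union>y\<in>B. {x \<in> A. f x = y})"
    using assms(2) by auto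
  then have "card A = card (\<Union>y\<in>B. {x \<in> A. f x = y})"
    by simp
  also have "\<dots> \<le> (\<Sum>y\<in>B. card {x \<in> A. f x = y})"
    by (rule card_UN_le[OF assms(1)])
  also have "\<dots> \<le> card B * c"
    using sum_bounded_above[of B "\<lambda>y. card {x \<in> A. f x = y}" c] assms(4) by simp
  finally show ?thesis .
qed

text \<open>The congruence is the trace that closing the walk leaves on its labels. Even
  multiplicities are relaxed to the lower bound 2, which limits the number of distinct letters to
  \<open>k\<close>.\<close>

definition unbalanced_words :: "nat \<Rightarrow> nat \<Rightarrow> nat list set" where
  "unbalanced_words m k = {l. length l = 2 * k \<and> set l \<subseteq> {..<m} \<and> (\<forall>v\<in>set l. 2 \<le> count_list l v) \<and>
     mset (evens k l) \<noteq> mset (odds k l) \<and> [(\<Sum>q<2 * k. (- 1) ^ q * int (l ! q)) = 0] (mod int m)}"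

lemma finite_patterned: "finite {l. length l = h \<and> set l \<subseteq> {..<m :: nat} \<and> P l}"
  by (rule finite_subset[OF _ finite_lists_length_eq[of "{..<m}" h]]) auto

text \<open>The word is determined by its letters at the positions in \<open>R\<close>; solving the congruence for the
  letter at \<open>r\<close>, whose coefficient does not vanish, saves a factor \<open>m\<close>.\<close>

lemma card_patterned_words_le:
  fixes g :: "nat \<Rightarrow> nat" and c :: "nat \<Rightarrow> int"
  assumes m: "0 < m" and R: "R = g ` {..<2 * k}" "R \<subseteq> {..<2 * k}" and r: "r \<in> R"
    and c: "\<And>s. c s = (\<Sum>q | q < 2 * k \<and> g q = s. (- 1) ^ q)" and cr: "c r \<noteq> 0"
  shows "card {l. length l = 2 * k \<and> set l \<subseteq> {..<m} \<and> (\<forall>q<2 * k. l ! q = l ! g q) \<and>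
      [(\<Sum>q<2 * k. (- 1) ^ q * int (l ! q)) = 0] (mod int m)} \<le> m ^ (card R - 1) * (2 * k)"
    (is "card ?S \<le> _")
proof -
  have finR: "finite R"
    using R by simp
  have sum: "(\<Sum>q<2 * k. (- 1) ^ q * int (l ! q)) = c r * int (l ! r) + (\<Sum>s\<in>R - {r}. c s * int (l ! s))"
    if "\<forall>q<2 * k. l ! q = l ! g q" for l
  \<comment> \<open>Positions carrying the same letter are collected: \<open>c s\<close> is the sum
    of the signs over the class represented by \<open>s\<close>.\<close>
  proof -
    have "(\<Sum>q<2 * k. (- 1) ^ q * int (l ! q)) = (\<Sum>s\<in>R. \<Sum>q | q \<in> {..<2 * k} \<and> g q = s. (- 1) ^ q * int (l ! q))"
      unfolding R by (rule sum.image_gen) simp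
    also have "\<dots> = (\<Sum>s\<in>R. c s * int (l ! s))"
      using that unfolding c by (intro sum.cong) (auto simp: sum_distrib_right intro!: sum.cong)
    also have "\<dots> = c r * int (l ! r) + (\<Sum>s\<in>R - {r}. c s * int (l ! s))"
      by (rule sum.remove[OF finR r])
    finally show ?thesis .
  qed
  let ?f = "\<lambda>l. restrict ((!) l) (R - {r})"
  let ?T = "(R - {r}) \<rightarrow>\<^sub>E {..<m}"
  have "card ?S \<le> card ?T * (2 * k)"
  proof (rule card_le_mult_card_fibre)
    show "finite ?T"
      using finR by (intro finite_PiE) auto
    show "?f ` ?S \<subseteq> ?T"
    proof (rule image_subsetI)
      fix l assume l: "l \<in> ?S"
      have "l ! s \<in> {..<m}" if "s \<in> R" for s
      proof -
        have "s < length l" "set l \<subseteq> {..<m}"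
          using that l R(2) by auto
        then show ?thesis
          by (meson nth_mem subsetD)
      qed
      then show "?f l \<in> ?T"
        by auto
    qed
    fix y assume "y \<in> ?T"
    let ?F = "{l \<in> ?S. ?f l = y}"
    define d where "d = (\<Sum>s\<in>R - {r}. c s * int (y s))"
    show "finite ?F"
      by (rule finite_subset[OF _ finite_patterned[of "2 * k" m "\<lambda>_. True"]]) auto
    have y: "l ! s = y s" if "l \<in> ?F" "s \<in> R - {r}" for l s
      using that by auto
    have "inj_on (\<lambda>l. l ! r) ?F"
    proof (rule inj_onI)
      fix l l' assume l: "l \<in> ?F" "l' \<in> ?F" and eq: "l ! r = l' ! r"
      have on_R: "l ! s = l' ! s" if "s \<in> R" for s
        using y[OF l(1), of s] y[OF l(2), of s] eq that by (cases "s = r") auto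
      show "l = l'"
      proof (rule nth_equalityI)
        fix q assume "q < length l"
        then have "q < 2 * k"
          using l by simp
        then have "l ! q = l ! g q" "l' ! q = l' ! g q" "g q \<in> R"
          using l R(1) by auto
        then show "l ! q = l' ! q"
          using on_R by simp
      qed (use l in simp)
    qed
    moreover have "(\<lambda>l. l ! r) ` ?F \<subseteq> {x. x < m \<and> [c r * int x + d = 0] (mod int m)}"
    proof (rule image_subsetI)
      fix l assume l: "l \<in> ?F"
      then have "r < length l" "set l \<subseteq> {..<m}"
        using r R(2) by auto
      then have "l ! r < m"
        using nth_mem by blast
      moreover have "(\<Sum>s\<in>R - {r}. c s * int (l ! s)) = d"
        unfolding d_def using y[OF l] by (intro sum.cong) auto
      moreover have "\<forall>q<2 * k. l ! q = l ! g q" "[(\<Sum>q<2 * k. (- 1) ^ q * int (l ! q)) = 0] (mod int m)"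
        using l by blast+
      ultimately show "l ! r \<in> {x. x < m \<and> [c r * int x + d = 0] (mod int m)}"
        by (simp only: sum mem_Collect_eq)
    qed
    moreover have "finite {x. x < m \<and> [c r * int x + d = 0] (mod int m)}"
      by simp
    ultimately have "card ?F \<le> card {x. x < m \<and> [c r * int x + d = 0] (mod int m)}"
      by (rule card_inj_on_le)
    also have "\<dots> \<le> nat \<bar>c r\<bar>"
      by (rule card_linear_cong_le[OF cr m])
    \<comment> \<open>The coefficient is a sum of signs over a class of at most \<open>2 * k\<close>
      positions, so the congruence has at most \<open>2 * k\<close> solutions.\<close>
    also have "\<bar>c r\<bar> \<le> (\<Sum>q | q < 2 * k \<and> g q = r. \<bar>(- 1) ^ q\<bar>)"
      unfolding c by (rule sum_abs)
    then have "nat \<bar>c r\<bar> \<le> card {q. q < 2 * k \<and> g q = r}"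
      by simp
    also have "\<dots> \<le> card {..<2 * k}"
      by (rule card_mono) auto
    finally show "card ?F \<le> 2 * k"
      by simp
  qed
  then show ?thesis
    using finR r by (simp add: card_PiE)
qed

lemma card_set_le_half:
  assumes "\<And>v. v \<in> set l \<Longrightarrow> 2 \<le> count_list l v"
  shows "2 * card (set l) \<le> length l"
proof -
  have "2 * card (set l) = (\<Sum>v\<in>set l. 2)"
    by simp
  also have "\<dots> \<le> (\<Sum>v\<in>set l. count_list l v)"
    using assms by (rule sum_mono)
  finally show ?thesis
    by (simp add: sum_count_set)
qed

text \<open>A word is sorted by its pattern \<open>g\<close>, sending each position to the first one
  with the same letter, and by the representative \<open>r\<close> of a letter whose multiplicities
  at even and odd positions differ. There are at most \<open>(2 * k) ^ (2 * k) * (2 * k)\<close>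
  such pairs, and each has at most \<open>k\<close> free letters tied by one nontrivial
  congruence.\<close>

lemma card_unbalanced_words_le:
  assumes m: "0 < m"
  shows "card (unbalanced_words m k) \<le> (2 * k) ^ (2 * k) * (2 * k) * (m ^ (k - 1) * (2 * k))"
proof -
  let ?h = "2 * k"
  define c where "c g s = (\<Sum>q | q < ?h \<and> g q = s. (- 1 :: int) ^ q)" for g :: "nat \<Rightarrow> nat" and s
  define W where "W = (\<lambda>(g :: nat \<Rightarrow> nat, r :: nat). {l. length l = ?h \<and> set l \<subseteq> {..<m} \<and> (\<forall>q<?h. l ! q = l ! g q) \<and>
      [(\<Sum>q<?h. (- 1) ^ q * int (l ! q)) = 0] (mod int m)})"
  define I where "I = {(g, r). g \<in> {..<?h} \<rightarrow>\<^sub>E {..<?h} \<and> r \<in> g ` {..<?h} \<and> card (g ` {..<?h}) \<le> k \<and> c g r \<noteq> 0}"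
  have I: "I \<subseteq> ({..<?h} \<rightarrow>\<^sub>E {..<?h}) \<times> {..<?h}"
    by (auto simp: I_def)
  have fin: "finite (({..<?h} \<rightarrow>\<^sub>E {..<?h}) \<times> {..<?h})"
    by (intro finite_cartesian_product finite_PiE) auto
  have "unbalanced_words m k \<subseteq> (\<Union>i\<in>I. W i)"
  proof
    fix l assume "l \<in> unbalanced_words m k"
    then have len: "length l = ?h" and sub: "set l \<subseteq> {..<m}" and two: "\<And>v. v \<in> set l \<Longrightarrow> 2 \<le> count_list l v"
      and unbal: "mset (evens k l) \<noteq> mset (odds k l)"
      and closed: "[(\<Sum>q<?h. (- 1) ^ q * int (l ! q)) = 0] (mod int m)"
      by (auto simp: unbalanced_words_def)
    \<comment> \<open>The restriction to positions below \<open>2 * k\<close> makes \<open>g\<close>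
      extensional, so that patterns range over a finite function space.\<close>
    define g where "g = (\<lambda>q\<in>{..<?h}. LEAST j. l ! j = l ! q)"
    have gq: "l ! g q = l ! q" "g q \<le> q" if "q < ?h" for q
      using that LeastI[of "\<lambda>j. l ! j = l ! q" q] Least_le[of "\<lambda>j. l ! j = l ! q" q] by (auto simp: g_def)
    have g_eq: "g q = g q' \<longleftrightarrow> l ! q = l ! q'" if "q < ?h" "q' < ?h" for q q'
    proof
      assume "g q = g q'"
      then show "l ! q = l ! q'"
        using gq(1)[OF that(1)] gq(1)[OF that(2)] by simp
    qed (use that in \<open>simp add: g_def\<close>)
    have "inj_on ((!) l) (g ` {..<?h})"
    proof (rule inj_onI, clarify)
      fix q q' assume "q < ?h" "q' < ?h" "l ! g q = l ! g q'"
      then show "g q = g q'"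
        using gq(1)[of q] gq(1)[of q'] g_eq[of q q'] by simp
    qed
    then have "card (g ` {..<?h}) = card ((!) l ` g ` {..<?h})"
      by (rule card_image[symmetric])
    also have "(!) l ` g ` {..<?h} \<subseteq> set l"
      using gq len by (auto simp: image_iff)
    then have "card ((!) l ` g ` {..<?h}) \<le> card (set l)"
      by (intro card_mono) auto
    finally have card_g: "card (g ` {..<?h}) \<le> k"
      using card_set_le_half[of l] two len by simp
    obtain v where v: "count (mset (evens k l)) v \<noteq> count (mset (odds k l)) v"
      using unbal by (auto simp: multiset_eq_iff)
    then have "v \<in># mset (evens k l) + mset (odds k l)"
      by (metis count_union add_is_0 count_eq_zero_iff)
    then have "v \<in> set l"
      using mset_evens_odds[OF len] by (metis set_mset_mset)
    then obtain q0 where q0: "q0 < ?h" "l ! q0 = v"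
      using len by (auto simp: in_set_conv_nth)
    \<comment> \<open>The coefficient of the letter \<open>v\<close> is the difference of its
      multiplicities at even and odd positions, hence nonzero by the choice of
      \<open>v\<close>.\<close>
    have "c g (g q0) = (\<Sum>q<?h. (- 1) ^ q * (if l ! q = v then 1 else 0))"
      unfolding c_def using g_eq q0 by (intro sum.mono_neutral_cong_left) auto
    also have "\<dots> = (\<Sum>x\<in>#mset (evens k l). if x = v then 1 else 0) - (\<Sum>x\<in>#mset (odds k l). if x = v then 1 else 0)"
      by (rule alternating_sum_evens_odds)
    also have "\<dots> = int (count (mset (evens k l)) v) - int (count (mset (odds k l)) v)"
    proof -
      have "(\<Sum>x\<in>#A. if x = v then 1 else 0) = int (count A v)" for A
        by (induction A) auto
      then show ?thesis
        by simp
    qed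
    also have "\<dots> \<noteq> 0"
      using v by simp
    finally have "(g, g q0) \<in> I"
      using card_g gq q0 unfolding I_def by (auto simp: g_def intro: le_less_trans)
    moreover have "l \<in> W (g, g q0)"
      using len sub closed gq by (simp add: W_def)
    ultimately show "l \<in> (\<Union>i\<in>I. W i)"
      by blast
  qed
  moreover have "finite (W i)" for i
    unfolding W_def by (cases i) (auto simp: finite_patterned)
  moreover have finI: "finite I"
    using I fin by (rule finite_subset)
  ultimately have "card (unbalanced_words m k) \<le> card (\<Union>i\<in>I. W i)"
    by (intro card_mono) auto
  also have "\<dots> \<le> (\<Sum>i\<in>I. card (W i))"
    by (rule card_UN_le[OF finI])
  also have "\<dots> \<le> (\<Sum>i\<in>I. m ^ (k - 1) * ?h)"
  proof (rule sum_mono, clarify)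
    fix g r assume "(g, r) \<in> I"
    then have g: "g ` {..<?h} \<subseteq> {..<?h}" and r: "r \<in> g ` {..<?h}" and k: "card (g ` {..<?h}) \<le> k"
      and cr: "c g r \<noteq> 0"
      by (auto simp: I_def)
    have "card (W (g, r)) \<le> m ^ (card (g ` {..<?h}) - 1) * ?h"
      unfolding W_def prod.case
      by (rule card_patterned_words_le[where c = "c g", OF m refl g r _ cr]) (simp add: c_def)
    also have "\<dots> \<le> m ^ (k - 1) * ?h"
      using m k by (intro mult_right_mono power_increasing) auto
    finally show "card (W (g, r)) \<le> m ^ (k - 1) * ?h" .
  qed
  also have "\<dots> \<le> ?h ^ ?h * ?h * (m ^ (k - 1) * ?h)"
  proof -
    have "card I \<le> ?h ^ ?h * ?h"
      using card_mono[OF fin I] by (simp add: card_cartesian_product card_PiE)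
    then show ?thesis
      unfolding sum_constant of_nat_id by (rule mult_right_mono) simp
  qed
  finally show ?thesis .
qed

text \<open>These are the circuits whose product of entries has nonzero mean under fair signs;
  \<open>m\<close> is the modulus and \<open>n\<close> the number of vertices.\<close>

definition even_circuits :: "nat \<Rightarrow> nat \<Rightarrow> nat \<Rightarrow> (nat \<times> nat list) set" where
  "even_circuits m n k = {(a, p) \<in> circuits n (2 * k). \<forall>v. even (count_list (labels (hankel_label m) a p) v)}"

lemma set_labels_hankel: "0 < m \<Longrightarrow> set (labels (hankel_label m) a p) \<subseteq> {..<m}"
  by (induction p arbitrary: a) (auto simp: hankel_label_def)

lemma closed_labels_cong:
  assumes "length p = 2 * k" "last (a # p) = a"
  shows "[(\<Sum>q<2 * k. (- 1) ^ q * int (labels (hankel_label m) a p ! q)) = 0] (mod int m)"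
  using alternating_sum_labels_cong[of m a p] assms by (simp del: last.simps)

text \<open>The first term counts the balanced circuits. An unbalanced circuit is determined by its
  base point and its label word, which gives the second term; it is of order \<open>n ^ k\<close>
  once \<open>m\<close> is at most a constant times \<open>n\<close> and \<open>k\<close> is
  positive.\<close>

theorem card_even_circuits_le:
  assumes n: "0 < n" and nm: "n \<le> m"
  shows "card (even_circuits m n k) \<le>
    fact k * n ^ (k + 1) + n * ((2 * k) ^ (2 * k) * (2 * k) * (m ^ (k - 1) * (2 * k)))"
proof -
  let ?l = "labels (hankel_label m)"
  let ?bal = "\<lambda>(a, p). mset (evens k (?l a p)) = mset (odds k (?l a p))"
  let ?U = "{x \<in> even_circuits m n k. \<not> ?bal x}"
  have m: "0 < m"
    using n nm by simp
  have fin: "finite (even_circuits m n k)"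
    by (rule finite_subset[OF _ finite_circuits]) (auto simp: even_circuits_def)
  have "card (even_circuits m n k) \<le> card ({x \<in> even_circuits m n k. ?bal x} \<union> ?U)"
    using fin by (intro card_mono) auto
  also have "\<dots> \<le> card {x \<in> even_circuits m n k. ?bal x} + card ?U"
    by (rule card_Un_le)
  also have "card {x \<in> even_circuits m n k. ?bal x} \<le> card {x \<in> circuits n (2 * k). ?bal x}"
    by (rule card_mono) (auto simp: finite_circuits even_circuits_def)
  also have "\<dots> \<le> fact k * n ^ (k + 1)"
    using card_circuits_balanced_le[OF nm, of k] by (simp add: case_prod_unfold)
  also have "card ?U \<le> card ({..<n} \<times> unbalanced_words m k)"
  proof (rule card_inj_on_le)
    let ?g = "\<lambda>(a, p). (a, ?l a p)"
    show "inj_on ?g ?U"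
    proof (rule inj_onI)
      fix x y assume xy: "x \<in> ?U" "y \<in> ?U" and eq: "?g x = ?g y"
      obtain a p p' where x: "x = (a, p)" and y: "y = (a, p')" and l: "?l a p = ?l a p'"
        using eq by (cases x; cases y) auto
      have "p = p'"
        using xy nm unfolding x y by (intro walk_determined_by_labels[OF _ _ _ l])
          (auto simp: even_circuits_def circuits_def)
      then show "x = y"
        using x y by simp
    qed
    show "?g ` ?U \<subseteq> {..<n} \<times> unbalanced_words m k"
    proof (rule image_subsetI)
      fix x assume "x \<in> ?U"
      then obtain a p where x: "x = (a, p)" and ap: "(a, p) \<in> even_circuits m n k"
        and unbal: "mset (evens k (?l a p)) \<noteq> mset (odds k (?l a p))"
        by auto
      have "2 \<le> count_list (?l a p) v" if "v \<in> set (?l a p)" for v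
      proof -
        have "even (count_list (?l a p) v)" "count_list (?l a p) v \<noteq> 0"
          using ap that by (auto simp: even_circuits_def count_list_0_iff)
        then show ?thesis
          by (cases "count_list (?l a p) v = 1") auto
      qed
      then show "?g x \<in> {..<n} \<times> unbalanced_words m k"
        unfolding x using ap unbal closed_labels_cong[of p k a m] set_labels_hankel[OF m]
        by (auto simp: even_circuits_def circuits_def unbalanced_words_def simp del: last.simps)
    qed
    show "finite ({..<n} \<times> unbalanced_words m k)"
      unfolding unbalanced_words_def by (simp add: finite_patterned)
  qed
  also have "\<dots> \<le> n * ((2 * k) ^ (2 * k) * (2 * k) * (m ^ (k - 1) * (2 * k)))"
    using card_unbalanced_words_le[OF m, of k] by (simp add: card_cartesian_product)
  finally show ?thesis
    by simp
qed

section \<open>Lower bound when the modulus equals the number of vertices\<close>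

lemma hankel_walk_exists:
  assumes "set l \<subseteq> {..<n}"
  obtains p where "length p = length l" "set p \<subseteq> {..<n}" "labels (hankel_label n) a p = l"
proof -
  have "\<exists>p. length p = length l \<and> set p \<subseteq> {..<n} \<and> labels (hankel_label n) a p = l"
    using assms
  proof (induction l arbitrary: a)
    case (Cons v l)
    obtain b where b: "b < n" "hankel_label n a b = v"
      using Cons.prems by (auto intro: hankel_label_surj[of v n a])
    obtain p where "length p = length l" "set p \<subseteq> {..<n}" "labels (hankel_label n) b p = l"
      using Cons.IH[of b] Cons.prems by auto
    with b show ?case
      by (intro exI[of _ "b # p"]) auto
  qed simp
  then show ?thesis
    using that by blast
qed

text \<open>Every label is reachable from every vertex, so label words can be prescribed. Choose a
  base point, \<open>k\<close> distinct labels in order for the even positions, and any of their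
  \<open>fact k\<close> arrangements for the odd ones. Different choices give different
  circuits.\<close>

theorem card_even_circuits_ge:
  assumes kn: "k \<le> n" 
  shows "n * (fact k * (n - k) ^ k) \<le> card (even_circuits n n k)"
proof -
  let ?l = "labels (hankel_label n)"
  let ?D = "{xs. length xs = k \<and> distinct xs \<and> set xs \<subseteq> {..<n}}"
  let ?T = "{..<n} \<times> (SIGMA xs:?D. permutations_of_set (set xs))"
  let ?g = "\<lambda>(a, p). (a, evens k (?l a p), odds k (?l a p))"
  have finD: "finite ?D"
    using finite_patterned[of k n distinct] by (simp add: conj_ac)
  have "(n - k) ^ k \<le> card ?D"
  \<comment> \<open>The number of injective lists is a falling factorial whose \<open>k\<close>
    factors all exceed \<open>n - k\<close>.\<close>
  proof -
    have "(n - k) ^ k = (\<Prod>i\<in>{n - k + 1..n}. n - k)"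
      using kn by simp
    also have "\<dots> \<le> \<Prod>{n - k + 1..n}"
      by (rule prod_mono) auto
    also have "\<dots> = card ?D"
      using card_lists_distinct_length_eq[of "{..<n}" k] kn by simp
    finally show ?thesis .
  qed
  then have "n * (fact k * (n - k) ^ k) \<le> n * (\<Sum>xs\<in>?D. card (permutations_of_set (set xs)))"
    by (simp add: distinct_card mult.commute)
  also have "\<dots> = card ?T"
    using finD by (simp add: card_cartesian_product card_SigmaI)
  also have "\<dots> \<le> card (?g ` even_circuits n n k)"
  proof (rule card_mono)
    show "finite (?g ` even_circuits n n k)"
      by (rule finite_imageI, rule finite_subset[OF _ finite_circuits]) (auto simp: even_circuits_def)
    show "?T \<subseteq> ?g ` even_circuits n n k"
    proof
      fix z assume "z \<in> ?T"
      then obtain a xs ys where z: "z = (a, xs, ys)" and a: "a \<in> {..<n}"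
        and xs: "length xs = k" "distinct xs" "set xs \<subseteq> {..<n}"
        and "ys \<in> permutations_of_set (set xs)"
        by auto
      then have ys: "set ys = set xs" "distinct ys"
        by (auto simp: permutations_of_set_def)
      then have mset_eq: "mset xs = mset ys"
        using xs set_eq_iff_mset_eq_distinct by metis
      then have len_ys: "length ys = k"
        using xs(1) mset_eq_length by metis
      define l where "l = map (\<lambda>q. if even q then xs ! (q div 2) else ys ! (q div 2)) [0..<2 * k]"
      have l: "length l = 2 * k" "evens k l = xs" "odds k l = ys"
        using xs(1) len_ys by (auto simp: l_def evens_def odds_def intro!: nth_equalityI)
      have mset_l: "mset l = mset xs + mset ys"
        using mset_evens_odds[OF l(1)] l by simp
      then have "set l \<subseteq> {..<n}"
        using xs ys by (metis set_mset_mset set_mset_union Un_absorb)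
      then obtain p where p: "length p = length l" "set p \<subseteq> {..<n}" "?l a p = l"
        by (rule hankel_walk_exists)
      have len_p: "length p = 2 * k"
        using p(1) l(1) by simp
      \<comment> \<open>Being balanced makes the alternating sum vanish, so the end point is
        congruent to the base point; both lie below \<open>n\<close>, hence the walk closes.\<close>
      have "(\<Sum>q<length p. (- 1) ^ q * int (?l a p ! q)) = 0"
        unfolding p(3) len_p alternating_sum_evens_odds l mset_eq by simp
      then have "[0 = int a - int (last (a # p))] (mod int n)"
        using alternating_sum_labels_cong[of n a p] len_p by (simp del: last.simps)
      then have "[int a = int (last (a # p))] (mod int n)"
        by (simp add: cong_iff_dvd_diff dvd_diff_commute del: last.simps)
      then have "[a = last (a # p)] (mod n)"
        by (simp add: cong_int_iff del: last.simps)
      moreover have "last (a # p) < n"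
        using a p(2) by (cases "p = []") (auto dest: last_in_set)
      ultimately have "last (a # p) = a"
        using a by (simp add: cong_def del: last.simps)
      then have "(a, p) \<in> circuits n (2 * k)"
        using a p(2) len_p by (simp add: circuits_def)
      moreover have "even (count_list l v)" for v
        using arg_cong[OF mset_l, of "\<lambda>M. count M v"] by (simp add: mset_eq count_mset)
      ultimately have "(a, p) \<in> even_circuits n n k"
        using p(3) by (simp add: even_circuits_def)
      moreover have "?g (a, p) = (a, xs, ys)"
        using p(3) l by simp
      ultimately show "z \<in> ?g ` even_circuits n n k"
        unfolding z
        by (metis (no_types, lifting) image_eqI)
    qed
  qed
  also have "\<dots> \<le> card (even_circuits n n k)"
    by (rule card_image_le, rule finite_subset[OF _ finite_circuits]) (auto simp: even_circuits_def)
  finally show ?thesis .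
qed

subsection \<open>Spectral averages\<close>

definition spectral_mean :: "(real \<Rightarrow> real) \<Rightarrow> real mat \<Rightarrow> real" where
  "spectral_mean f A = (\<Sum>r\<in>#proots (char_poly A). f r) / real (dim_row A)"

text \<open>The law of a uniformly chosen eigenvalue. The image under the identity passes from the
  discrete sigma-algebra to the Borel one, as \<open>real_distribution\<close> demands.\<close>

definition spectral_measure :: "real mat \<Rightarrow> real measure" where
  "spectral_measure A = distr (measure_pmf (pmf_of_multiset (proots (char_poly A)))) borel (\<lambda>r. r)"

lemma real_distribution_spectral_measure: "real_distribution (spectral_measure A)"
  unfolding spectral_measure_def by (rule prob_space.real_distribution_distr[OF measure_pmf.prob_space_axioms]) simp

lemma sum_mset_eq_sum_count:
  fixes f :: "'a \<Rightarrow> 'b :: comm_semiring_1"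
  assumes "finite S" "set_mset M \<subseteq> S"
  shows "(\<Sum>r\<in>#M. f r) = (\<Sum>r\<in>S. of_nat (count M r) * f r)"
  using assms(2)
proof (induction M)
  case (add x M)
  have "(\<Sum>r\<in>S. of_nat (count (add_mset x M) r) * f r) =
      (\<Sum>r\<in>S. (if r = x then f r else 0) + of_nat (count M r) * f r)"
    by (intro sum.cong) (auto simp: distrib_right)
  also have "\<dots> = f x + (\<Sum>r\<in>S. of_nat (count M r) * f r)"
    using add.prems assms(1) by (simp add: sum.distrib)
  finally show ?case
    using add by simp
qed simp

text \<open>There are exactly \<open>n\<close> real eigenvalues with multiplicity, so dividing by
  the dimension and normalizing the multiset agree. Size 0 is excluded because an empty multiset
  carries no uniform distribution.\<close>

lemma
  assumes A: "A \<in> carrier_mat n n" and sym: "\<And>i j. i < n \<Longrightarrow> j < n \<Longrightarrow> A $$ (i, j) = A $$ (j, i)" and n: "0 < n"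
  shows integral_spectral_measure: "f \<in> borel_measurable borel \<Longrightarrow> (\<integral>t. f t \<partial>spectral_measure A) = spectral_mean f A"
    and cdf_spectral_measure: "cdf (spectral_measure A) = esd A"
proof -
  let ?M = "proots (char_poly A)"
  have size: "size ?M = n"
    by (rule size_proots_symmetric[OF A sym])
  then have ne: "?M \<noteq> {#}"
    using n by auto
  have int: "(\<integral>t. f t \<partial>spectral_measure A) = spectral_mean f A" if "f \<in> borel_measurable borel" for f
  proof -
    have "(\<integral>t. f t \<partial>spectral_measure A) = (\<integral>t. f t \<partial>measure_pmf (pmf_of_multiset ?M))"
      unfolding spectral_measure_def using that by (subst integral_distr) auto
    also have "\<dots> = (\<Sum>r\<in>set_mset ?M. f r * (count ?M r / n))"
      using ne size by (subst integral_measure_pmf_real[of "set_mset ?M"]) auto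
    also have "\<dots> = spectral_mean f A"
      using A unfolding spectral_mean_def sum_mset_eq_sum_count[OF finite_set_mset subset_refl] sum_divide_distrib
      by (simp add: mult.commute)
    finally show ?thesis .
  qed
  show "f \<in> borel_measurable borel \<Longrightarrow> (\<integral>t. f t \<partial>spectral_measure A) = spectral_mean f A"
    by (rule int)
  show "cdf (spectral_measure A) = esd A"
  proof
    fix t
    have "cdf (spectral_measure A) t = (\<integral>s. indicator {..t} s \<partial>spectral_measure A)"
      by (simp add: cdf_def spectral_measure_def)
    also have "\<dots> = spectral_mean (indicator {..t}) A"
      by (rule int) simp
    also have "\<dots> = esd A t"
    proof -
      have "(\<Sum>r\<in>#N. indicator {..t} r) = real (size {#l \<in># N. l \<le> t#})" for N
        by (induction N) auto
      then show ?thesis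
        by (simp add: spectral_mean_def esd_def)
    qed
    finally show "cdf (spectral_measure A) t = esd A t" .
  qed
qed

lemma spectral_mean_mono:
  assumes "\<And>t. f t \<le> g t"
  shows "spectral_mean f A \<le> spectral_mean g A"
  unfolding spectral_mean_def using assms by (intro divide_right_mono sum_mset_mono) auto

lemma spectral_mean_add_mult:
  "spectral_mean (\<lambda>t. f t + c * g t) A = spectral_mean f A + c * spectral_mean g A"
  unfolding spectral_mean_def sum_mset.distrib sum_mset_distrib_left[symmetric] by (simp add: add_divide_distrib)

lemma abs_spectral_mean_le:
  assumes A: "A \<in> carrier_mat n n" and sym: "\<And>i j. i < n \<Longrightarrow> j < n \<Longrightarrow> A $$ (i, j) = A $$ (j, i)" and n: "0 < n"
    and f: "\<And>t. \<bar>f t\<bar> \<le> B"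
  shows "\<bar>spectral_mean f A\<bar> \<le> B"
proof -
  have c: "spectral_mean (\<lambda>_. c) A = c" for c
    using A n size_proots_symmetric[OF A sym] by (simp add: spectral_mean_def)
  have "spectral_mean f A \<le> spectral_mean (\<lambda>_. B) A"
    using f abs_le_D1 by (intro spectral_mean_mono) blast
  moreover have "spectral_mean (\<lambda>_. - B) A \<le> spectral_mean f A"
    using f by (intro spectral_mean_mono) (metis abs_le_D2 minus_le_iff)
  ultimately show ?thesis
    by (simp add: c)
qed

text \<open>Weak convergence of distribution functions tested against a bounded continuous function.
  The index is shifted by one to avoid the matrix of size 0.\<close>

lemma spectral_mean_tendsto:
  assumes A: "\<And>n. A n \<in> carrier_mat n n" and sym: "\<And>n i j. i < n \<Longrightarrow> j < n \<Longrightarrow> A n $$ (i, j) = A n $$ (j, i)"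
    and F: "real_distribution F" and conv: "weak_conv (\<lambda>n. esd (A n)) (cdf F)"
    and f: "\<And>t. isCont f t" "\<And>t. \<bar>f t\<bar> \<le> B"
  shows "(\<lambda>n. spectral_mean f (A (Suc n))) \<longlonglongrightarrow> (\<integral>t. f t \<partial>F)"
proof -
  note spec = A[of "Suc _"] sym zero_less_Suc
  have meas: "f \<in> borel_measurable borel"
    using f(1) by (intro borel_measurable_continuous_onI continuous_at_imp_continuous_on) auto
  have "weak_conv_m (\<lambda>n. spectral_measure (A (Suc n))) F"
    unfolding weak_conv_m_def weak_conv_def
  proof (intro allI impI)
    fix t assume "isCont (cdf F) t"
    then have "(\<lambda>n. esd (A (Suc n)) t) \<longlonglongrightarrow> cdf F t"
      using conv by (intro LIMSEQ_Suc[of "\<lambda>n. esd (A n) t"]) (simp add: weak_conv_def)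
    then show "(\<lambda>n. cdf (spectral_measure (A (Suc n))) t) \<longlonglongrightarrow> cdf F t"
      by (simp add: cdf_spectral_measure[OF spec])
  qed
  then have "(\<lambda>n. integral\<^sup>L (spectral_measure (A (Suc n))) f) \<longlonglongrightarrow> integral\<^sup>L F f"
    using f by (intro weak_conv_imp_integral_bdd_continuous_conv[where B = B])
      (auto simp: F real_distribution_spectral_measure)
  then show ?thesis
    by (simp add: integral_spectral_measure[OF spec meas])
qed

subsection \<open>Fair signs as input\<close>

text \<open>The sample space lives on the type over which \<open>is_LSD\<close> quantifies, so that
  the limit applies to this input.\<close>

definition coin_space :: "(nat \<Rightarrow> real) measure" where
  "coin_space = (\<Pi>\<^sub>M i\<in>UNIV. measure_pmf (pmf_of_set {- 1, 1}))"

text \<open>Sending every value other than \<open>1\<close> to \<open>- 1\<close> makes the coins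
  signs everywhere and not merely almost everywhere.\<close>

definition coin :: "nat \<Rightarrow> (nat \<Rightarrow> real) \<Rightarrow> real" where
  "coin i \<omega> = (if \<omega> i = 1 then 1 else - 1)"

interpretation coin_product: product_prob_space "\<lambda>_ :: nat. measure_pmf (pmf_of_set {- 1, 1 :: real})" UNIV
  by unfold_locales

interpretation coin_space: prob_space coin_space
  unfolding coin_space_def by (intro prob_space_PiM measure_pmf.prob_space_axioms)

lemma coordinate_measurable: "(\<lambda>\<omega>. \<omega> i) \<in> coin_space \<rightarrow>\<^sub>M measure_pmf (pmf_of_set {- 1, 1})"
  unfolding coin_space_def by (rule measurable_component_singleton) simp

lemma coin_measurable [measurable]: "coin i \<in> borel_measurable coin_space"
proof -
  have "(\<lambda>r. if r = 1 then 1 else - 1 :: real) \<circ> (\<lambda>\<omega>. \<omega> i) \<in> borel_measurable coin_space"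
    by (rule measurable_comp[OF coordinate_measurable]) simp
  then show ?thesis
    by (simp add: o_def coin_def[abs_def])
qed

text \<open>The joint law of the coordinates is the product of their marginals, which characterizes
  independence; the coins are functions of single coordinates.\<close>

lemma indep_coins: "coin_space.indep_vars (\<lambda>_. borel) coin UNIV"
proof -
  let ?P = "\<lambda>_ :: nat. measure_pmf (pmf_of_set {- 1, 1 :: real})"
  have "distr coin_space (PiM UNIV ?P) (\<lambda>\<omega>. \<lambda>i\<in>UNIV. \<omega> i) = distr coin_space coin_space (\<lambda>\<omega>. \<omega>)"
    unfolding coin_space_def by (simp add: restrict_UNIV)
  also have "\<dots> = PiM UNIV (\<lambda>i. distr coin_space (?P i) (\<lambda>\<omega>. \<omega> i))"
    unfolding coin_space_def using coin_product.PiM_component by simp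
  finally have "coin_space.indep_vars ?P (\<lambda>i \<omega>. \<omega> i) UNIV"
    by (rule coin_space.indep_vars_iff_distr_eq_PiM'[THEN iffD2, rotated 2])
      (simp, rule coordinate_measurable)
  then have "coin_space.indep_vars (\<lambda>_. borel) (\<lambda>i \<omega>. (\<lambda>r. if r = 1 then 1 else - 1) (\<omega> i)) UNIV"
    by (rule coin_space.indep_vars_compose2) simp
  then show ?thesis
    by (simp add: coin_def[abs_def])
qed

lemma abs_coin [simp]: "\<bar>coin i \<omega>\<bar> = 1" and coin_sq [simp]: "(coin i \<omega>)\<^sup>2 = 1"
  by (simp_all add: coin_def)

lemma integrable_coin_pow: "integrable coin_space (\<lambda>\<omega>. coin i \<omega> ^ j)"
  by (rule coin_space.integrable_const_bound[where B = 1]) (auto simp: power_abs)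

lemma expectation_coin_pow: "coin_space.expectation (\<lambda>\<omega>. coin i \<omega> ^ j) = (if even j then 1 else 0)"
proof (cases "even j")
  case True
  then have "coin i \<omega> ^ j = 1" for \<omega>
    by (auto simp: coin_def)
  then show ?thesis
    using True coin_space.prob_space by simp
next
  case False
  let ?P = "measure_pmf (pmf_of_set {- 1, 1 :: real})"
  have "coin i \<omega> ^ j = (if \<omega> i = 1 then 1 else - 1)" for \<omega>
    using False by (simp add: coin_def)
  then have "coin_space.expectation (\<lambda>\<omega>. coin i \<omega> ^ j) =
      (\<integral>r. (if r = 1 then 1 else - 1) \<partial>distr coin_space ?P (\<lambda>\<omega>. \<omega> i))"
    by (subst integral_distr[OF coordinate_measurable]) simp_all
  also have "distr coin_space ?P (\<lambda>\<omega>. \<omega> i) = ?P"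
    unfolding coin_space_def by (rule coin_product.PiM_component) simp
  also have "(\<integral>r. (if r = 1 then 1 else - 1) \<partial>?P) = (0 :: real)"
    by (subst integral_pmf_of_set) auto
  finally show ?thesis
    using False by simp
qed

lemma input_sequence_coin: "input_sequence coin_space coin"
proof -
  have "standardized coin_space coin"
    using integrable_coin_pow[of _ 1] expectation_coin_pow[of _ 1] coin_space.prob_space
    by (simp add: standardized_def)
  moreover have "uniformly_bounded coin_space coin"
    by (auto simp: uniformly_bounded_def intro: exI[of _ 1])
  ultimately show ?thesis
    by (simp add: input_sequence_def coin_space.prob_space_axioms indep_coins)
qed

lemma prod_list_map_eq_prod_count:
  fixes f :: "'a \<Rightarrow> 'b :: comm_monoid_mult"
  assumes "finite S" "set l \<subseteq> S"
  shows "prod_list (map f l) = (\<Prod>v\<in>S. f v ^ count_list l v)"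
  using assms(2)
proof (induction l)
  case (Cons a l)
  have "(\<Prod>v\<in>S. f v ^ count_list (a # l) v) = (\<Prod>v\<in>S. (if v = a then f v else 1) * f v ^ count_list l v)"
    by (intro prod.cong) auto
  also have "\<dots> = f a * (\<Prod>v\<in>S. f v ^ count_list l v)"
    using Cons.prems assms(1) by (simp add: prod.distrib)
  finally show ?case
    using Cons by simp
qed simp

text \<open>Equal letters are grouped into powers of independent coins. Each power has mean 1 or 0
  according to the parity of its exponent.\<close>

lemma
  shows expectation_coin_word: "coin_space.expectation (\<lambda>\<omega>. prod_list (map (\<lambda>i. coin i \<omega>) l)) =
      (if \<forall>v. even (count_list l v) then 1 else 0)"
    and integrable_coin_word: "integrable coin_space (\<lambda>\<omega>. prod_list (map (\<lambda>i. coin i \<omega>) l))"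
proof -
  have eq: "prod_list (map (\<lambda>i. coin i \<omega>) l) = (\<Prod>v\<in>set l. coin v \<omega> ^ count_list l v)" for \<omega>
    by (rule prod_list_map_eq_prod_count) auto
  have "coin_space.indep_vars (\<lambda>_. borel) coin (set l)"
    by (rule coin_space.indep_vars_subset[OF indep_coins]) simp
  then have indep: "coin_space.indep_vars (\<lambda>_. borel) (\<lambda>v \<omega>. coin v \<omega> ^ count_list l v) (set l)"
    by (rule coin_space.indep_vars_compose2) simp
  have "coin_space.expectation (\<lambda>\<omega>. prod_list (map (\<lambda>i. coin i \<omega>) l)) =
      (\<Prod>v\<in>set l. if even (count_list l v) then 1 else 0)"
    unfolding eq by (subst coin_space.indep_vars_lebesgue_integral[OF _ indep])
      (simp_all add: integrable_coin_pow expectation_coin_pow)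
  also have "\<dots> = (if \<forall>v. even (count_list l v) then 1 else 0)"
    by (auto simp: count_list_0_iff intro!: prod.neutral) (metis count_notin even_zero)
  finally show "coin_space.expectation (\<lambda>\<omega>. prod_list (map (\<lambda>i. coin i \<omega>) l)) =
      (if \<forall>v. even (count_list l v) then 1 else 0)" .
  show "integrable coin_space (\<lambda>\<omega>. prod_list (map (\<lambda>i. coin i \<omega>) l))"
    unfolding eq by (rule coin_space.indep_vars_integrable[OF _ indep]) (simp_all add: integrable_coin_pow)
qed

section \<open>Moments and measurability for matrices of fair signs\<close>

lemma A_mat_carrier: "A_mat \<theta> x n \<in> carrier_mat n n"
  by (simp add: A_mat_def)

lemma A_mat_nth: "i < n \<Longrightarrow> j < n \<Longrightarrow>
    A_mat \<theta> x n $$ (i, j) = x (hankel_label (nat \<lfloor>real n / \<theta>\<rfloor>) i j) / sqrt (real n)"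
  by (simp add: A_mat_def link_def hankel_label_def)

lemma A_mat_symmetric: "i < n \<Longrightarrow> j < n \<Longrightarrow> A_mat \<theta> x n $$ (i, j) = A_mat \<theta> x n $$ (j, i)"
  by (simp add: A_mat_nth hankel_label_def add.commute)

lemma prod_labels_A_mat:
  assumes "a < n" "set p \<subseteq> {..<n}"
  shows "prod_list (labels (\<lambda>i j. A_mat \<theta> x n $$ (i, j)) a p) =
    prod_list (map x (labels (hankel_label (nat \<lfloor>real n / \<theta>\<rfloor>)) a p)) / sqrt (real n) ^ length p"
  using assms by (induction p arbitrary: a) (auto simp: A_mat_nth)

text \<open>The exponent \<open>k + 1\<close> combines \<open>k\<close> from the
  \<open>2 * k\<close> factors \<open>sqrt n\<close> with one from averaging over the
  eigenvalues.\<close>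

lemma spectral_mean_A_mat_power:
  "spectral_mean (\<lambda>t. t ^ (2 * k)) (A_mat \<theta> x n) =
    (\<Sum>(a, p)\<in>circuits n (2 * k). prod_list (map x (labels (hankel_label (nat \<lfloor>real n / \<theta>\<rfloor>)) a p))) / real n ^ (k + 1)"
proof -
  have "(\<Sum>r\<in>#proots (char_poly (A_mat \<theta> x n)). r ^ (2 * k)) =
      (\<Sum>(a, p)\<in>circuits n (2 * k). prod_list (labels (\<lambda>i j. A_mat \<theta> x n $$ (i, j)) a p))"
    using sum_proots_symmetric[OF A_mat_carrier A_mat_symmetric] trace_pow_circuits[OF A_mat_carrier]
    by metis
  also have "\<dots> = (\<Sum>(a, p)\<in>circuits n (2 * k).
      prod_list (map x (labels (hankel_label (nat \<lfloor>real n / \<theta>\<rfloor>)) a p)) / real n ^ k)"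
    by (intro sum.cong refl) (auto simp: circuits_def prod_labels_A_mat power_mult)
  finally show ?thesis
    using A_mat_carrier[of \<theta> x n] by (simp add: spectral_mean_def case_prod_unfold sum_divide_distrib mult.commute)
qed

lemma
  shows integrable_moment_coin: "integrable coin_space (\<lambda>\<omega>. spectral_mean (\<lambda>t. t ^ (2 * k)) (A_mat \<theta> (\<lambda>i. coin i \<omega>) n))"
    and expectation_moment_coin:
      "coin_space.expectation (\<lambda>\<omega>. spectral_mean (\<lambda>t. t ^ (2 * k)) (A_mat \<theta> (\<lambda>i. coin i \<omega>) n)) =
        card (even_circuits (nat \<lfloor>real n / \<theta>\<rfloor>) n k) / real n ^ (k + 1)"
proof -
  let ?m = "nat \<lfloor>real n / \<theta>\<rfloor>"
  show "integrable coin_space (\<lambda>\<omega>. spectral_mean (\<lambda>t. t ^ (2 * k)) (A_mat \<theta> (\<lambda>i. coin i \<omega>) n))"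
    unfolding spectral_mean_A_mat_power case_prod_unfold
    by (intro integrable_divide Bochner_Integration.integrable_sum integrable_coin_word)
  have "coin_space.expectation (\<lambda>\<omega>. spectral_mean (\<lambda>t. t ^ (2 * k)) (A_mat \<theta> (\<lambda>i. coin i \<omega>) n)) =
      (\<Sum>(a, p)\<in>circuits n (2 * k). if \<forall>v. even (count_list (labels (hankel_label ?m) a p) v) then 1 else 0) / real n ^ (k + 1)"
    unfolding spectral_mean_A_mat_power case_prod_unfold
    by (subst integral_divide_zero, subst Bochner_Integration.integral_sum)
      (simp_all add: integrable_coin_word expectation_coin_word)
  also have "(\<Sum>(a, p)\<in>circuits n (2 * k). if \<forall>v. even (count_list (labels (hankel_label ?m) a p) v) then 1 else 0) =
      real (card (even_circuits ?m n k))"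
    by (simp add: even_circuits_def case_prod_unfold finite_circuits flip: sum.inter_filter)
  finally show "coin_space.expectation (\<lambda>\<omega>. spectral_mean (\<lambda>t. t ^ (2 * k)) (A_mat \<theta> (\<lambda>i. coin i \<omega>) n)) =
      card (even_circuits ?m n k) / real n ^ (k + 1)" .
qed

text \<open>The first \<open>m\<close> coins take only finitely many joint values, and every
  function on a finite discrete space is measurable. Thus no regularity of the eigenvalues in the
  entries has to be established.\<close>

lemma measurable_function_of_finitely_many_coins:
  assumes "\<And>x y. (\<And>i. i < m \<Longrightarrow> x i = y i) \<Longrightarrow> G x = G y"
  shows "(\<lambda>\<omega>. G (\<lambda>i. coin i \<omega>)) \<in> borel_measurable coin_space"
proof -
  let ?L = "{l. set l \<subseteq> {- 1, 1 :: real} \<and> length l = m}"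
  let ?\<xi> = "\<lambda>\<omega>. map (\<lambda>i. coin i \<omega>) [0..<m]"
  have "?\<xi> \<in> coin_space \<rightarrow>\<^sub>M count_space ?L"
  proof (subst measurable_count_space_eq2)
    show "finite ?L"
      by (rule finite_lists_length_eq) simp
    have "?\<xi> -` {l} \<inter> space coin_space = {\<omega> \<in> space coin_space. \<forall>i<m. coin i \<omega> = l ! i}" if "l \<in> ?L" for l
    proof -
      have "length l = m"
        using that by simp
      then have "?\<xi> \<omega> = l \<longleftrightarrow> (\<forall>i<m. coin i \<omega> = l ! i)" for \<omega>
        unfolding list_eq_iff_nth_eq by simp
      then show ?thesis
        by blast
    qed
    moreover have "{\<omega> \<in> space coin_space. \<forall>i<m. coin i \<omega> = l ! i} \<in> sets coin_space" for l
      by measurable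
    ultimately show "?\<xi> \<in> space coin_space \<rightarrow> ?L \<and> (\<forall>l\<in>?L. ?\<xi> -` {l} \<inter> space coin_space \<in> sets coin_space)"
      by (simp add: Pi_iff) (simp add: coin_def image_subset_iff)
  qed
  then have "(\<lambda>\<omega>. G (\<lambda>i. ?\<xi> \<omega> ! i)) \<in> borel_measurable coin_space"
    by (rule measurable_compose) simp
  moreover have "G (\<lambda>i. ?\<xi> \<omega> ! i) = G (\<lambda>i. coin i \<omega>)" for \<omega>
    by (rule assms) simp
  ultimately show ?thesis
    by simp
qed

text \<open>A positive modulus keeps all labels below it, so only that many coins occur in the
  matrix; reduction modulo 0 would leave the indices unchanged.\<close>

lemma spectral_mean_coin_measurable:
  assumes "0 < nat \<lfloor>real n / \<theta>\<rfloor>"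
  shows "(\<lambda>\<omega>. spectral_mean f (A_mat \<theta> (\<lambda>i. coin i \<omega>) n)) \<in> borel_measurable coin_space"
proof (rule measurable_function_of_finitely_many_coins[where m = "nat \<lfloor>real n / \<theta>\<rfloor>"])
  fix x y :: "nat \<Rightarrow> real"
  assume "\<And>i. i < nat \<lfloor>real n / \<theta>\<rfloor> \<Longrightarrow> x i = y i"
  then have "A_mat \<theta> x n = A_mat \<theta> y n"
    using assms unfolding A_mat_def link_def by (intro cong_mat) auto
  then show "spectral_mean f (A_mat \<theta> x n) = spectral_mean f (A_mat \<theta> y n)"
    by simp
qed

text \<open>The lower bound makes a vertex and a label determine the next vertex; the upper bound
  turns powers of the modulus in the error term into powers of \<open>n\<close>.\<close>

lemma link_modulus_bounds:
  assumes "1 / 2 < \<theta>" "\<theta> \<le> 1"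
  shows "n \<le> nat \<lfloor>real n / \<theta>\<rfloor>" "nat \<lfloor>real n / \<theta>\<rfloor> \<le> 2 * n"
proof -
  have "real n * \<theta> \<le> real n" "real n \<le> real n * (2 * \<theta>)"
    using assms mult_left_mono[of \<theta> 1 "real n"] mult_left_mono[of 1 "2 * \<theta>" "real n"] by simp_all
  then have "real n \<le> real n / \<theta>" "real n / \<theta> \<le> 2 * real n"
    using assms by (simp_all add: field_simps)
  then show "n \<le> nat \<lfloor>real n / \<theta>\<rfloor>" "nat \<lfloor>real n / \<theta>\<rfloor> \<le> 2 * n"
    by linarith+
qed

subsection \<open>Moments of the limit\<close>

text \<open>Almost sure convergence along the coin input passes to expectations by dominated
  convergence, the constant \<open>B\<close> being the dominating function.\<close>

lemma expected_spectral_mean_tendsto: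
  assumes \<theta>: "1 / 2 < \<theta>" "\<theta> \<le> 1" and F: "is_LSD (A_mat \<theta>) F"
    and f: "\<And>t. isCont f t" "\<And>t. \<bar>f t\<bar> \<le> B"
  shows "(\<lambda>n. coin_space.expectation (\<lambda>\<omega>. spectral_mean f (A_mat \<theta> (\<lambda>i. coin i \<omega>) (Suc n)))) \<longlonglongrightarrow> (\<integral>t. f t \<partial>F)"
    and "integrable coin_space (\<lambda>\<omega>. spectral_mean f (A_mat \<theta> (\<lambda>i. coin i \<omega>) (Suc n)))"
proof -
  interpret F: real_distribution F
    using F by (simp add: is_LSD_def)
  have pos: "0 < nat \<lfloor>real (Suc n) / \<theta>\<rfloor>" for n
    by (rule less_le_trans[OF zero_less_Suc link_modulus_bounds(1)[OF \<theta>]])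
  note meas [measurable] = spectral_mean_coin_measurable[OF pos]
  have bound: "norm (spectral_mean f (A_mat \<theta> (\<lambda>i. coin i \<omega>) (Suc n))) \<le> B" for n \<omega>
    using abs_spectral_mean_le[OF A_mat_carrier A_mat_symmetric zero_less_Suc f(2)] by simp
  have "AE \<omega> in coin_space. weak_conv (\<lambda>n. esd (A_mat \<theta> (\<lambda>i. coin i \<omega>) n)) (cdf F)"
    using F input_sequence_coin by (auto simp: is_LSD_def)
  then have "AE \<omega> in coin_space. (\<lambda>n. spectral_mean f (A_mat \<theta> (\<lambda>i. coin i \<omega>) (Suc n))) \<longlonglongrightarrow> (\<integral>t. f t \<partial>F)"
    by eventually_elim (rule spectral_mean_tendsto[OF A_mat_carrier A_mat_symmetric F.real_distribution_axioms _ f])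
  then have "(\<lambda>n. coin_space.expectation (\<lambda>\<omega>. spectral_mean f (A_mat \<theta> (\<lambda>i. coin i \<omega>) (Suc n))))
      \<longlonglongrightarrow> coin_space.expectation (\<lambda>\<omega>. \<integral>t. f t \<partial>F)"
    by (intro integral_dominated_convergence[where w = "\<lambda>_. B"]) (use bound in auto)
  then show "(\<lambda>n. coin_space.expectation (\<lambda>\<omega>. spectral_mean f (A_mat \<theta> (\<lambda>i. coin i \<omega>) (Suc n)))) \<longlonglongrightarrow> (\<integral>t. f t \<partial>F)"
    by (simp add: coin_space.prob_space)
  show "integrable coin_space (\<lambda>\<omega>. spectral_mean f (A_mat \<theta> (\<lambda>i. coin i \<omega>) (Suc n)))"
    by (rule coin_space.integrable_const_bound[where B = B]) (use bound meas in auto)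
qed

lemma expected_moment_le:
  assumes \<theta>: "1 / 2 < \<theta>" "\<theta> \<le> 1" and k: "1 \<le> k"
  obtains C where "\<And>n. coin_space.expectation (\<lambda>\<omega>. spectral_mean (\<lambda>t. t ^ (2 * k)) (A_mat \<theta> (\<lambda>i. coin i \<omega>) (Suc n)))
    \<le> fact k + C / real (Suc n)"
proof
  fix n
  define N where "N = Suc n"
  define c where "c = (2 * k) ^ (2 * k) * (2 * k) * (2 ^ (k - 1) * (2 * k))"
  let ?m = "nat \<lfloor>real N / \<theta>\<rfloor>"
  have m: "N \<le> ?m" "?m \<le> 2 * N"
    using link_modulus_bounds[OF \<theta>] by auto
  have "card (even_circuits ?m N k) \<le> fact k * N ^ (k + 1) + N * ((2 * k) ^ (2 * k) * (2 * k) * (?m ^ (k - 1) * (2 * k)))"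
    by (rule card_even_circuits_le) (use m in \<open>auto simp: N_def\<close>)
  also have "\<dots> \<le> fact k * N ^ (k + 1) + N * ((2 * k) ^ (2 * k) * (2 * k) * ((2 * N) ^ (k - 1) * (2 * k)))"
    by (intro add_left_mono mult_left_mono mult_right_mono power_mono m(2)) simp_all
  also have "\<dots> = fact k * N ^ (k + 1) + c * N ^ k"
  proof -
    obtain j where j: "k = Suc j"
      using k by (cases k) auto
    \<comment> \<open>Positivity of \<open>k\<close> lets the outer factor \<open>N\<close> combine
      with \<open>N ^ (k - 1)\<close> to \<open>N ^ k\<close>.\<close>
    show ?thesis
      by (simp only: c_def j diff_Suc_1 power_mult_distrib power_Suc mult.commute mult.left_commute mult.assoc)
  qed
  finally have "real (card (even_circuits ?m N k)) \<le> real (fact k * N ^ (k + 1) + c * N ^ k)"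
    by (simp only: of_nat_le_iff)
  then have "real (card (even_circuits ?m N k)) / real N ^ (k + 1) \<le> (fact k * real N ^ (k + 1) + c * real N ^ k) / real N ^ (k + 1)"
    by (intro divide_right_mono) simp_all
  also have "\<dots> = fact k + c / real N"
    by (simp add: N_def add_divide_distrib)
  finally show "coin_space.expectation (\<lambda>\<omega>. spectral_mean (\<lambda>t. t ^ (2 * k)) (A_mat \<theta> (\<lambda>i. coin i \<omega>) (Suc n)))
      \<le> fact k + real c / real (Suc n)"
    unfolding expectation_moment_coin N_def .
qed

text \<open>Powers are unbounded and cannot be tested against weak convergence, but their truncation
  at \<open>K\<close> can; it only lowers the expected moment, whose bound tends to
  \<open>fact k\<close>.\<close>

lemma LSD_truncated_moment_le:
  assumes \<theta>: "1 / 2 < \<theta>" "\<theta> \<le> 1" and k: "1 \<le> k" and F: "is_LSD (A_mat \<theta>) F" and K: "0 \<le> K"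
  shows "(\<integral>t. min (t ^ (2 * k)) K \<partial>F) \<le> fact k"
proof -
  obtain C where C: "\<And>n. coin_space.expectation (\<lambda>\<omega>. spectral_mean (\<lambda>t. t ^ (2 * k)) (A_mat \<theta> (\<lambda>i. coin i \<omega>) (Suc n)))
      \<le> fact k + C / real (Suc n)"
    using expected_moment_le[OF \<theta> k] by blast
  have "isCont (\<lambda>t :: real. min (t ^ (2 * k)) K) t" "\<bar>min (t ^ (2 * k)) K\<bar> \<le> K" for t
    using K by (auto intro!: continuous_intros)
  note lim = expected_spectral_mean_tendsto[OF \<theta> F this]
  have "(\<lambda>n. fact k + C / real (Suc n)) \<longlonglongrightarrow> fact k + 0"
    by (intro tendsto_add tendsto_const LIMSEQ_Suc lim_const_over_n)
  moreover have "coin_space.expectation (\<lambda>\<omega>. spectral_mean (\<lambda>t. min (t ^ (2 * k)) K) (A_mat \<theta> (\<lambda>i. coin i \<omega>) (Suc n)))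
      \<le> fact k + C / real (Suc n)" for n
    by (rule order_trans[OF integral_mono[OF lim(2) integrable_moment_coin] C]) (auto intro: spectral_mean_mono)
  ultimately show ?thesis
    using lim(1) by (intro LIMSEQ_le[where Y = "\<lambda>n. fact k + C / real (Suc n)"]) auto
qed

text \<open>Monotone convergence as the truncation level grows through the naturals gives
  integrability and the bound together.\<close>

lemma
  assumes \<theta>: "1 / 2 < \<theta>" "\<theta> \<le> 1" and k: "1 \<le> k" and F: "is_LSD (A_mat \<theta>) F"
  shows LSD_integrable_even_power: "integrable F (\<lambda>t. t ^ (2 * k))"
    and LSD_even_moment_le: "moment F (2 * k) \<le> fact k"
proof -
  interpret F: real_distribution F
    using F by (simp add: is_LSD_def)
  let ?f = "\<lambda>K t. min (t ^ (2 * k)) (real K)"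
  let ?I = "\<lambda>K. \<integral>t. ?f K t \<partial>F"
  have int: "integrable F (?f K)" for K
    by (rule F.integrable_const_bound[where B = "real K"]) auto
  have le: "?I K \<le> fact k" for K
    by (rule LSD_truncated_moment_le[OF \<theta> k F]) simp
  have mono: "incseq ?I"
    by (intro incseq_SucI integral_mono int) auto
  obtain L where L: "?I \<longlonglongrightarrow> L"
    using incseq_convergent[OF mono, of "fact k"] le by blast
  have ptw: "(\<lambda>K. ?f K t) \<longlonglongrightarrow> t ^ (2 * k)" for t
  proof (rule tendsto_eventually)
    obtain K0 where "t ^ (2 * k) \<le> real K0"
      using real_arch_simple by blast
    then show "\<forall>\<^sub>F K in sequentially. ?f K t = t ^ (2 * k)"
      by (intro eventually_sequentiallyI[of K0]) (simp add: min_def)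
  qed
  have "has_bochner_integral F (\<lambda>t. t ^ (2 * k)) L"
    by (rule has_bochner_integral_monotone_convergence[OF int _ _ L]) (auto simp: ptw mono_def min_le_iff_disj)
  then have "integrable F (\<lambda>t. t ^ (2 * k))" "(\<integral>t. t ^ (2 * k) \<partial>F) = L"
    by (auto simp: has_bochner_integral_iff)
  then show "integrable F (\<lambda>t. t ^ (2 * k))" "moment F (2 * k) \<le> fact k"
    using LIMSEQ_le_const2[OF L, of "fact k"] le by (auto simp: moment_def)
qed

text \<open>Under weak convergence alone a moment could escape to infinity. The uniform bound on the
  expected moment of order \<open>4 * k\<close> limits what truncation at \<open>K\<close> loses to
  order \<open>1 / K\<close>.\<close>

lemma LSD_one_even_moment_ge:
  assumes k: "1 \<le> k" and F: "is_LSD (A_mat 1) F"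
  shows "fact k \<le> moment F (2 * k)"
proof -
  interpret F: real_distribution F
    using F by (simp add: is_LSD_def)
  have \<theta>: "1 / 2 < (1 :: real)" "(1 :: real) \<le> 1"
    by auto
  have k2: "1 \<le> 2 * k"
    using k by simp
  let ?E = "\<lambda>f n. coin_space.expectation (\<lambda>\<omega>. spectral_mean f (A_mat 1 (\<lambda>i. coin i \<omega>) (Suc n)))"
  obtain C where C: "\<And>n. ?E (\<lambda>t. t ^ (2 * (2 * k))) n \<le> fact (2 * k) + C / real (Suc n)"
    using expected_moment_le[OF \<theta> k2] by blast
  have bound: "fact k \<le> moment F (2 * k) + fact (2 * k) / K" if K: "0 < K" for K :: real
  proof -
    let ?f = "\<lambda>t. min (t ^ (2 * k)) K"
    have cont: "isCont ?f t" "\<bar>?f t\<bar> \<le> K" for t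
      using K by (auto intro!: continuous_intros)
    note lim = expected_spectral_mean_tendsto[OF \<theta> F cont]
    \<comment> \<open>Where the truncation is active, \<open>t ^ (2 * k)\<close> exceeds
      \<open>K\<close>, so multiplying it by \<open>t ^ (2 * k) / K\<close> only enlarges
      it.\<close>
    have ptw: "t ^ (2 * k) \<le> ?f t + 1 / K * t ^ (2 * (2 * k))" for t
    proof (cases "t ^ (2 * k) \<le> K")
      case False
      then have "K * t ^ (2 * k) \<le> t ^ (2 * k) * t ^ (2 * k)"
        using K by (intro mult_right_mono) auto
      also have "\<dots> = t ^ (2 * (2 * k))"
        by (simp add: mult_2 power_add)
      finally have "t ^ (2 * k) \<le> 1 / K * t ^ (2 * (2 * k))"
        using K by (simp add: field_simps)
      then show ?thesis
        using K False by simp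
    next
      case True
      have "0 \<le> t ^ (2 * (2 * k))"
        by (rule zero_le_even_power) simp
      with True K show ?thesis
        by (simp add: divide_nonneg_pos)
    qed
    have lower: "fact k * ((real (Suc n) - k) / real (Suc n)) ^ k \<le> ?E (\<lambda>t. t ^ (2 * k)) n" if "k \<le> Suc n" for n
    proof -
      have "real (Suc n * (fact k * (Suc n - k) ^ k)) \<le> real (card (even_circuits (Suc n) (Suc n) k))"
        using card_even_circuits_ge[OF that] by (simp only: of_nat_le_iff)
      moreover have "nat \<lfloor>real (Suc n) / 1\<rfloor> = Suc n"
        by (simp only: div_by_1 floor_of_nat nat_int)
      ultimately have "real (Suc n * (fact k * (Suc n - k) ^ k)) / real (Suc n) ^ (k + 1) \<le> ?E (\<lambda>t. t ^ (2 * k)) n"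
        unfolding expectation_moment_coin by (simp only:) (intro divide_right_mono, simp_all only: zero_le_power of_nat_0_le_iff)
      moreover have "real (Suc n * (fact k * (Suc n - k) ^ k)) / real (Suc n) ^ (k + 1) =
          fact k * ((real (Suc n) - k) / real (Suc n)) ^ k"
      proof -
        have "real (Suc n * (fact k * (Suc n - k) ^ k)) = real (Suc n) * (fact k * (real (Suc n) - real k) ^ k)"
          using that by (simp only: of_nat_mult of_nat_power of_nat_fact of_nat_diff)
        then show ?thesis
          by (simp add: power_divide del: of_nat_Suc of_nat_mult)
      qed
      ultimately show ?thesis
        by simp
    qed
    have upper: "?E (\<lambda>t. t ^ (2 * k)) n \<le> ?E ?f n + 1 / K * (fact (2 * k) + C / real (Suc n))" for n
    proof -
      have "?E (\<lambda>t. t ^ (2 * k)) n \<le> coin_space.expectation (\<lambda>\<omega>. spectral_mean ?f (A_mat 1 (\<lambda>i. coin i \<omega>) (Suc n)) +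
          1 / K * spectral_mean (\<lambda>t. t ^ (2 * (2 * k))) (A_mat 1 (\<lambda>i. coin i \<omega>) (Suc n)))"
        unfolding spectral_mean_add_mult[symmetric]
        by (intro integral_mono integrable_moment_coin spectral_mean_mono ptw)
          (unfold spectral_mean_add_mult, intro Bochner_Integration.integrable_add integrable_mult_right lim(2) integrable_moment_coin)
      also have "\<dots> = ?E ?f n + 1 / K * ?E (\<lambda>t. t ^ (2 * (2 * k))) n"
        by (subst Bochner_Integration.integral_add[OF lim(2) integrable_mult_right[OF integrable_moment_coin]])
          (simp only: integral_mult_right_zero)
      also have "\<dots> \<le> ?E ?f n + 1 / K * (fact (2 * k) + C / real (Suc n))"
        using C[of n] K by (intro add_left_mono mult_left_mono) auto
      finally show ?thesis .
    qed
    have "(\<lambda>n. ((real n - k) / real n)) \<longlonglongrightarrow> 1"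
      by real_asymp
    then have "(\<lambda>n. fact k * ((real (Suc n) - k) / real (Suc n)) ^ k) \<longlonglongrightarrow> fact k * 1 ^ k"
      by (intro tendsto_mult tendsto_const tendsto_power LIMSEQ_Suc)
    moreover have "(\<lambda>n. ?E ?f n + 1 / K * (fact (2 * k) + C / real (Suc n))) \<longlonglongrightarrow> (\<integral>t. ?f t \<partial>F) + 1 / K * (fact (2 * k) + 0)"
      by (intro tendsto_add tendsto_mult tendsto_const lim(1) LIMSEQ_Suc lim_const_over_n)
    moreover have "fact k * ((real (Suc n) - k) / real (Suc n)) ^ k \<le> ?E ?f n + 1 / K * (fact (2 * k) + C / real (Suc n))"
      if "k \<le> n" for n
      using order_trans[OF lower upper] that by (meson le_SucI)
    then have "\<exists>N. \<forall>n\<ge>N. fact k * ((real (Suc n) - k) / real (Suc n)) ^ k \<le> ?E ?f n + 1 / K * (fact (2 * k) + C / real (Suc n))"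
      by blast
    ultimately have "fact k * 1 ^ k \<le> (\<integral>t. ?f t \<partial>F) + 1 / K * (fact (2 * k) + 0)"
      by (rule LIMSEQ_le)
    moreover have "(\<integral>t. ?f t \<partial>F) \<le> moment F (2 * k)"
      unfolding moment_def
      by (intro integral_mono LSD_integrable_even_power[OF \<theta> k F] F.integrable_const_bound[where B = K])
        (use cont(2) in auto)
    ultimately show ?thesis
      by simp
  qed
  \<comment> \<open>The truncation level tends to infinity along positive integers, removing the
    error term.\<close>
  have "(\<lambda>n. moment F (2 * k) + fact (2 * k) / real (Suc n)) \<longlonglongrightarrow> moment F (2 * k) + 0"
    by (intro tendsto_add tendsto_const LIMSEQ_Suc lim_const_over_n)
  then show ?thesis
    using bound by (intro LIMSEQ_le_const[of _ "moment F (2 * k)" "fact k"]) auto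
qed

lemma A_mat_one: "A_mat 1 = reverse_circulant"
  by (intro ext) (simp add: A_mat_def reverse_circulant_def link_def)

text \<open>Integrability is asserted explicitly because the integral of a non-integrable function
  is \<open>0\<close> by convention, which would make the inequality hollow. For the other two
  distributions the nonzero value \<open>fact k\<close> already forces it.\<close>

theorem proposition3p1:
  fixes \<theta> :: real and k :: nat and F_theta F_one F_RC :: "real measure"
  assumes "1 / 2 < \<theta>" and "\<theta> < 1" and "k \<ge> 1"
    and "is_LSD (A_mat \<theta>) F_theta"
    and "is_LSD (A_mat 1) F_one"
    and "is_LSD reverse_circulant F_RC"
  shows "integrable F_theta (\<lambda>t. t ^ (2 * k)) \<and>
    moment F_theta (2 * k) \<le> moment F_one (2 * k) \<and>
    moment F_one (2 * k) = moment F_RC (2 * k) \<and>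
    moment F_RC (2 * k) = fact k"
proof -
  have one: "moment F (2 * k) = fact k" if "is_LSD (A_mat 1) F" for F
    using LSD_even_moment_le[OF _ _ assms(3) that] LSD_one_even_moment_ge[OF assms(3) that] by simp
  have "moment F_one (2 * k) = fact k" "moment F_RC (2 * k) = fact k"
    using one assms(5,6) by (simp_all add: A_mat_one)
  moreover have "integrable F_theta (\<lambda>t. t ^ (2 * k))" "moment F_theta (2 * k) \<le> fact k"
    using LSD_integrable_even_power[OF assms(1) _ assms(3,4)] LSD_even_moment_le[OF assms(1) _ assms(3,4)] assms(2)
    by simp_all
  ultimately show ?thesis
    by simp
qed

end
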